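(* Let $A$ be a bounded linear operator on a complex Banach space $X$. Then each of the following conditions implies that $r(A)=\|A\|$: (1) $\displaystyle\sup_{t>0} t\,\|Ae^{-tA}\|\le e^{-1}$. (2) $\displaystyle\sup_{t>0} t\,\|Ae^{-t^mA^m}\|\le (me)^{-1/m}$ for some integer $m>1$. (3) $\displaystyle\sup_{t>0}\|e^{-tA}-e^{-stA}\|\le (s-1)s^{-s/(s-1)}$ for some $s>1$. (4) $\displaystyle\sup_{t>0}\|e^{-(s+i)tA}-e^{-(s-i)tA}\|\le \frac{2e^{-s\arctan(1/s)}}{\sqrt{1+s^2}}$ for some $s\ge 0$. In each case, strict inequality implies that $A=0$.
   Context: All Banach spaces are complex. $r(A)$ is the spectral radius of $A$ and $\|\cdot\|$ is the operator norm; $e$ is the base of the natural logarithm. For $s=0$ in (4), $\arctan(1/s)$ is read as $\pi/2$, so the right-hand side equals $2$. *)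

theory Defs
  imports "HOL-Analysis.Analysis"
begin

text \<open>
  Complex normed and complex Banach spaces.  The real structure is kept as the restriction of
  scalars of the complex one, so that the library of real normed spaces remains applicable.
\<close>

class scaleC =
  fixes scaleC :: "complex \<Rightarrow> 'a \<Rightarrow> 'a"  (infixr \<open>*\<^sub>C\<close> 75)

class complex_vector = real_vector + scaleC +
  assumes scaleC_add_right: "a *\<^sub>C (x + y) = a *\<^sub>C x + a *\<^sub>C y"
    and scaleC_add_left: "(a + b) *\<^sub>C x = a *\<^sub>C x + b *\<^sub>C x"
    and scaleC_scaleC: "a *\<^sub>C b *\<^sub>C x = (a * b) *\<^sub>C x"
    and scaleC_one: "1 *\<^sub>C x = x"
    and scaleR_scaleC: "r *\<^sub>R x = complex_of_real r *\<^sub>C x"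

class complex_normed_vector = complex_vector + real_normed_vector +
  assumes norm_scaleC: "norm (a *\<^sub>C x) = cmod a * norm x"

class cbanach = complex_normed_vector + banach

lemma bounded_linear_scaleC:
  "bounded_linear (\<lambda>x :: 'a :: complex_normed_vector. c *\<^sub>C x)"
proof (rule bounded_linear_intro[where K = "cmod c"])
  fix x y :: 'a and r :: real
  show "c *\<^sub>C (x + y) = c *\<^sub>C x + c *\<^sub>C y" by (rule scaleC_add_right)
  show "c *\<^sub>C r *\<^sub>R x = r *\<^sub>R c *\<^sub>C x"
    by (simp add: scaleR_scaleC scaleC_scaleC mult.commute)
  show "norm (c *\<^sub>C x) \<le> norm x * cmod c" by (simp add: norm_scaleC mult.commute)
qed

text \<open>
  Operators are elements of the library type of bounded real-linear maps, whose norm is the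
  operator norm; complex linearity is the additional predicate below.
\<close>

definition clinear_op ::
    "('a :: complex_normed_vector \<Rightarrow>\<^sub>L 'b :: complex_normed_vector) \<Rightarrow> bool" where
  "clinear_op T \<longleftrightarrow> (\<forall>c x. blinfun_apply T (c *\<^sub>C x) = c *\<^sub>C blinfun_apply T x)"

instantiation blinfun :: (real_normed_vector, complex_normed_vector) complex_normed_vector
begin

lift_definition scaleC_blinfun :: "complex \<Rightarrow> 'a \<Rightarrow>\<^sub>L 'b \<Rightarrow> 'a \<Rightarrow>\<^sub>L 'b"
  is "\<lambda>c T x. c *\<^sub>C T x"
  by (rule bounded_linear_compose[OF bounded_linear_scaleC])

instance
proof
  fix a b :: complex and r :: real and S T :: "'a \<Rightarrow>\<^sub>L 'b"
  show "a *\<^sub>C (S + T) = a *\<^sub>C S + a *\<^sub>C T"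
    by transfer (simp add: scaleC_add_right)
  show "(a + b) *\<^sub>C T = a *\<^sub>C T + b *\<^sub>C T"
    by transfer (simp add: scaleC_add_left)
  show "a *\<^sub>C b *\<^sub>C T = (a * b) *\<^sub>C T"
    by transfer (simp add: scaleC_scaleC)
  show "1 *\<^sub>C T = T"
    by transfer (simp add: scaleC_one)
  show "r *\<^sub>R T = complex_of_real r *\<^sub>C T"
    by transfer (simp add: scaleR_scaleC)
  show "norm (a *\<^sub>C T) = cmod a * norm T"
  proof transfer
    fix a :: complex and T :: "'a \<Rightarrow> 'b"
    assume "bounded_linear T"
    then have "onorm (\<lambda>x. cmod a *\<^sub>R T x) = cmod a * onorm T"
      by (simp add: onorm_scaleR)
    then show "onorm (\<lambda>x. a *\<^sub>C T x) = cmod a * onorm T"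
      by (simp add: onorm_def norm_scaleC)
  qed
qed

end

definition op_pow :: "('a :: real_normed_vector \<Rightarrow>\<^sub>L 'a) \<Rightarrow> nat \<Rightarrow> ('a \<Rightarrow>\<^sub>L 'a)" where
  "op_pow T n = ((\<lambda>S. T o\<^sub>L S) ^^ n) id_blinfun"

text \<open>
  The exponential series is defined here because \<^const>\<open>exp\<close> requires a unital normed algebra
  with \<open>norm 1 = 1\<close>, which the type of operators is not (it includes operators on the zero space).
  It converges absolutely on a Banach space, see \<open>summable_op_exp\<close>.
\<close>

definition op_exp :: "('a :: banach \<Rightarrow>\<^sub>L 'a) \<Rightarrow> ('a \<Rightarrow>\<^sub>L 'a)" where
  "op_exp T = (\<Sum>n. op_pow T n /\<^sub>R fact n)"

lemma norm_op_pow_le: "norm (op_pow T n) \<le> norm T ^ n"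
proof (induction n)
  case 0
  show ?case by (simp add: op_pow_def norm_blinfun_id_le)
next
  case (Suc n)
  have "norm (op_pow T (Suc n)) \<le> norm T * norm (op_pow T n)"
    by (simp add: op_pow_def norm_blinfun_compose)
  also have "\<dots> \<le> norm T * norm T ^ n"
    by (intro mult_left_mono Suc.IH) simp
  finally show ?case by simp
qed

lemma summable_op_exp: "summable (\<lambda>n. norm (op_pow T n /\<^sub>R fact n))"
proof (rule summable_comparison_test'[where N = 0])
  show "summable (\<lambda>n. norm T ^ n /\<^sub>R fact n)" by (rule summable_exp_generic)
  show "norm (norm (op_pow T n /\<^sub>R fact n)) \<le> norm T ^ n /\<^sub>R fact n" for n
    by (simp add: norm_op_pow_le mult_left_mono)
qed

definition op_invertible :: "('a :: complex_normed_vector \<Rightarrow>\<^sub>L 'a) \<Rightarrow> bool" where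
  "op_invertible T \<longleftrightarrow>
     (\<exists>S. clinear_op S \<and> S o\<^sub>L T = id_blinfun \<and> T o\<^sub>L S = id_blinfun)"

definition spectrum :: "('a :: complex_normed_vector \<Rightarrow>\<^sub>L 'a) \<Rightarrow> complex set" where
  "spectrum T = {z. \<not> op_invertible (z *\<^sub>C id_blinfun - T)}"

text \<open>
  The spectrum is empty exactly when the space is zero; inserting \<open>0\<close> gives the spectral radius
  the value \<open>0\<close> there and changes nothing otherwise.
\<close>

definition spectral_radius :: "('a :: complex_normed_vector \<Rightarrow>\<^sub>L 'a) \<Rightarrow> real" where
  "spectral_radius T = Sup (insert 0 (cmod ` spectrum T))"

text \<open>\<open>arctan (1 / s)\<close> for \<open>s \<ge> 0\<close>, with its limit value at \<open>s = 0\<close>.\<close>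

definition arctan_recip :: "real \<Rightarrow> real" where
  "arctan_recip s = (if s = 0 then pi / 2 else arctan (1 / s))"

end

theory Submission
  imports Defs "HOL-Complex_Analysis.Cauchy_Integral_Formula"
begin

text \<open>
  Each of the four conditions bounds \<open>norm (f (t A))\<close> for all \<open>t > 0\<close> by the value \<open>M = f t0\<close> of a real
  entire function \<open>f\<close> at its first critical point \<open>t0 > 0\<close>, up to a constant factor:
  \<open>f z = z exp (- z^m)\<close> for the first two (with \<open>m = 1\<close> in the first), \<open>f z = exp (- z) - exp (- s z)\<close>
  for the third, and \<open>f z = exp (- s z) sin z\<close> for the fourth, where the difference of exponentials is
  \<open>- 2 \<i> f (t A)\<close>.

  The idea is to recover \<open>t A\<close> from \<open>f (t A)\<close>.  Let \<open>g w = \<Sum>n. c n w^n\<close> be the local inverse of \<open>f\<close>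
  at \<open>0\<close>.  It solves \<open>g' = h \<circ> g\<close> with \<open>h = 1 / f'\<close>, so if \<open>h\<close> has nonnegative coefficients, then so
  has \<open>g\<close>, and a comparison argument bounds its partial sums at \<open>M\<close> by \<open>t0\<close>
  (\<open>partial_sum_le_critical_point\<close>).  Hence \<open>t A = g (f (t A))\<close>, once known, gives
  \<open>t norm A \<le> \<Sum>n. c n M^n \<le> t0\<close>.

  The identity \<open>t A = g (f (t A))\<close> is shown for \<open>0 \<le> t < t0 / r A\<close> by continuation in \<open>t\<close>
  (\<open>norm_le_compositional_inverse\<close>).  The set of good \<open>t\<close> contains \<open>0\<close> and is closed.  It is open
  because both sides have the same image under \<open>f\<close> and \<open>f\<close> is injective near \<open>t A\<close> among commuting
  operators, as \<open>f' (t A)\<close> has the inverse \<open>h (t A)\<close> (\<open>fps_at_locally_injective\<close>).  This last series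
  converges because \<open>norm (A^n) \<le> K b^n\<close> for each \<open>b > r A\<close> (\<open>resolvent_imp_power_bound\<close>).

  Letting \<open>t\<close> tend to \<open>t0 / r A\<close> yields \<open>norm A \<le> r A\<close>; the other inequality is the Neumann series.
  If the bound is some \<open>m < M\<close>, then \<open>\<Sum>n. c n m^n < t0\<close>, so \<open>norm A\<close> is at most \<open>r A\<close> times a factor
  less than one, and \<open>A = 0\<close>.

  What depends on the case is that \<open>1 / f'\<close> has nonnegative coefficients and converges up to
  \<open>t0\<close>.  In the first three cases \<open>f'\<close> is, up to a positive constant, an exponential times \<open>1 - u\<close> with
  \<open>u \<ge> 0\<close> coefficientwise
  (\<open>inverse_one_minus\<close>); in the fourth it is \<open>exp (- s z) (cos z - s sin z)\<close>, whose reciprocal is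
  a secant up to shift and exponential factor (\<open>inverse_cos_minus_sin\<close>).
\<close>

section \<open>Real power series in a unital Banach algebra\<close>

text \<open>
  The norm of the unit is only bounded by one, so that the operators on the zero space, where
  \<open>1 = 0\<close>, form such an algebra too.
\<close>

class unital_banach_algebra = banach + real_normed_algebra + monoid_mult +
  assumes norm_one_le: "norm 1 \<le> 1"

instance real :: unital_banach_algebra
  by standard simp

lemma norm_power_le:
  fixes x :: "'b :: unital_banach_algebra"
  assumes "norm x \<le> R"
  shows "norm (x ^ n) \<le> R ^ n"
proof (induction n)
  case 0
  show ?case using norm_one_le by simp
next
  case (Suc n)
  have "norm (x ^ Suc n) \<le> norm x * norm (x ^ n)"
    by (simp add: norm_mult_ineq)
  also have "\<dots> \<le> R * R ^ n"
    using assms Suc norm_ge_zero[of x] by (intro mult_mono) (linarith | simp)+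
  finally show ?case by simp
qed

lemma power_scaleR:
  fixes x :: "'b :: unital_banach_algebra"
  shows "(t *\<^sub>R x) ^ n = t ^ n *\<^sub>R x ^ n"
  by (induction n) simp_all

definition fps_at :: "real fps \<Rightarrow> 'b \<Rightarrow> 'b :: unital_banach_algebra" where
  "fps_at F x = (\<Sum>n. fps_nth F n *\<^sub>R x ^ n)"

text \<open>
  Absolute convergence is measured by \<open>norm (x ^ n)\<close> rather than \<open>norm x ^ n\<close>: the reciprocal of the
  derivative has to be evaluated at elements whose norm may exceed its radius of convergence while
  their powers grow slowly enough.
\<close>

definition fps_abs_conv :: "real fps \<Rightarrow> 'b :: unital_banach_algebra \<Rightarrow> bool" where
  "fps_abs_conv F x \<longleftrightarrow> summable (\<lambda>n. \<bar>fps_nth F n\<bar> * norm (x ^ n))"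

lemma fps_at_real: "fps_at F x = eval_fps F x"
  by (simp add: fps_at_def eval_fps_def)

lemma fps_abs_conv_summable:
  assumes "fps_abs_conv F x"
  shows "summable (\<lambda>n. norm (fps_nth F n *\<^sub>R x ^ n))" "summable (\<lambda>n. fps_nth F n *\<^sub>R x ^ n)"
proof -
  show 1: "summable (\<lambda>n. norm (fps_nth F n *\<^sub>R x ^ n))"
    using assms by (simp add: fps_abs_conv_def)
  show "summable (\<lambda>n. fps_nth F n *\<^sub>R x ^ n)"
    by (rule summable_norm_cancel[OF 1])
qed

lemma fps_at_sums: "fps_abs_conv F x \<Longrightarrow> (\<lambda>n. fps_nth F n *\<^sub>R x ^ n) sums fps_at F x"
  unfolding fps_at_def by (intro summable_sums fps_abs_conv_summable)

lemma fps_abs_conv_bounded_powers: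
  assumes "\<And>n. norm (x ^ n) \<le> K * b ^ n" "0 \<le> b" "ereal b < fps_conv_radius F"
  shows "fps_abs_conv F x"
  unfolding fps_abs_conv_def
proof (rule summable_comparison_test')
  have "summable (\<lambda>n. norm (fps_nth F n * b ^ n))"
    using assms by (intro norm_summable_fps) auto
  then show "summable (\<lambda>n. K * (\<bar>fps_nth F n\<bar> * b ^ n))"
    using assms(2) by (intro summable_mult) (simp add: abs_mult)
  fix n
  have "\<bar>fps_nth F n\<bar> * norm (x ^ n) \<le> \<bar>fps_nth F n\<bar> * (K * b ^ n)"
    by (intro mult_left_mono assms) auto
  then show "norm (\<bar>fps_nth F n\<bar> * norm (x ^ n)) \<le> K * (\<bar>fps_nth F n\<bar> * b ^ n)"
    by (simp add: mult_ac)
qed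

lemma fps_abs_conv_entire:
  "fps_conv_radius F = \<infinity> \<Longrightarrow> fps_abs_conv F x"
  by (rule fps_abs_conv_bounded_powers[where K = 1 and b = "norm x"])
    (auto intro: norm_power_le)

lemma
  fixes x :: "'b :: unital_banach_algebra"
  assumes "fps_abs_conv F x" "fps_abs_conv G x"
  shows fps_abs_conv_mult: "fps_abs_conv (F * G) x"
    and fps_at_mult: "fps_at (F * G) x = fps_at F x * fps_at G x"
proof -
  show "fps_abs_conv (F * G) x"
    unfolding fps_abs_conv_def
  proof (rule summable_comparison_test')
    show "summable (\<lambda>n. \<Sum>i\<le>n. (\<bar>fps_nth F i\<bar> * norm (x ^ i)) * (\<bar>fps_nth G (n - i)\<bar> * norm (x ^ (n - i))))"
      using assms by (intro summable_Cauchy_product) (auto simp: fps_abs_conv_def)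
    fix n
    have "\<bar>fps_nth (F * G) n\<bar> * norm (x ^ n)
        \<le> (\<Sum>i\<le>n. \<bar>fps_nth F i * fps_nth G (n - i)\<bar>) * norm (x ^ n)"
      unfolding fps_mult_nth atLeast0AtMost by (intro mult_right_mono sum_abs) auto
    also have "\<dots> \<le> (\<Sum>i\<le>n. (\<bar>fps_nth F i\<bar> * norm (x ^ i)) * (\<bar>fps_nth G (n - i)\<bar> * norm (x ^ (n - i))))"
      unfolding sum_distrib_right
    proof (rule sum_mono)
      fix i assume "i \<in> {..n}"
      then have "x ^ n = x ^ i * x ^ (n - i)" by (simp flip: power_add)
      then have "norm (x ^ n) \<le> norm (x ^ i) * norm (x ^ (n - i))" by (simp add: norm_mult_ineq)
      then have "\<bar>fps_nth F i * fps_nth G (n - i)\<bar> * norm (x ^ n)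
          \<le> \<bar>fps_nth F i * fps_nth G (n - i)\<bar> * (norm (x ^ i) * norm (x ^ (n - i)))"
        by (intro mult_left_mono) auto
      then show "\<bar>fps_nth F i * fps_nth G (n - i)\<bar> * norm (x ^ n)
          \<le> (\<bar>fps_nth F i\<bar> * norm (x ^ i)) * (\<bar>fps_nth G (n - i)\<bar> * norm (x ^ (n - i)))"
        by (simp add: abs_mult mult_ac)
    qed
    finally show "norm (\<bar>fps_nth (F * G) n\<bar> * norm (x ^ n)) \<le> \<dots>" by simp
  qed
  have "fps_at F x * fps_at G x
      = (\<Sum>n. \<Sum>i\<le>n. (fps_nth F i *\<^sub>R x ^ i) * (fps_nth G (n - i) *\<^sub>R x ^ (n - i)))"
    unfolding fps_at_def by (intro Cauchy_product fps_abs_conv_summable assms)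
  also have "\<dots> = fps_at (F * G) x"
    unfolding fps_at_def fps_mult_nth atLeast0AtMost scaleR_sum_left
    by (intro suminf_cong sum.cong) (auto simp flip: power_add)
  finally show "fps_at (F * G) x = fps_at F x * fps_at G x" ..
qed

lemma fps_at_1: "fps_at 1 x = 1" and fps_abs_conv_1: "fps_abs_conv 1 x"
proof -
  have eq: "fps_nth (1 :: real fps) n *\<^sub>R x ^ n = (if n = 0 then 1 else 0)" for n
    by (cases n) auto
  show "fps_at 1 x = 1" unfolding fps_at_def eq by (rule sums_unique[symmetric], rule sums_single)
  show "fps_abs_conv 1 x" by (rule fps_abs_conv_entire) simp
qed

lemma fps_at_X: "fps_at fps_X x = x"
proof -
  have eq: "fps_nth (fps_X :: real fps) n *\<^sub>R x ^ n = (if n = 1 then x else 0)" for n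
    by (simp add: fps_X_def)
  show ?thesis unfolding fps_at_def eq by (rule sums_unique[symmetric], rule sums_single)
qed

lemma
  assumes "fps_abs_conv F x"
  shows fps_abs_conv_power: "fps_abs_conv (F ^ k) x"
    and fps_at_power: "fps_at (F ^ k) x = fps_at F x ^ k"
proof (induction k)
  case (Suc k)
  { case 1 show ?case using fps_abs_conv_mult[OF assms Suc(1)] by simp }
  { case 2 show ?case using fps_at_mult[OF assms Suc(1)] Suc by simp }
qed (simp_all add: fps_at_1 fps_abs_conv_1)

lemma fps_power_nth_nonneg:
  fixes c :: "real fps"
  assumes "\<And>j. j \<le> n \<Longrightarrow> 0 \<le> fps_nth c j"
  shows "0 \<le> fps_nth (c ^ k) n"
  using assms
proof (induction k arbitrary: n)
  case (Suc k)
  then show ?case by (auto simp: fps_mult_nth intro!: sum_nonneg mult_nonneg_nonneg)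
qed (simp add: fps_one_nth)

lemma fps_abs_conv_norm_le:
  fixes x :: "'b :: unital_banach_algebra"
  assumes "fps_abs_conv F (M :: real)" "norm x \<le> M"
  shows "fps_abs_conv F x"
  unfolding fps_abs_conv_def
proof (rule summable_comparison_test')
  have "0 \<le> M" using assms(2) norm_ge_zero order_trans by blast
  then show "summable (\<lambda>n. \<bar>fps_nth F n\<bar> * M ^ n)"
    using assms(1) by (simp add: fps_abs_conv_def)
  show "norm (\<bar>fps_nth F n\<bar> * norm (x ^ n)) \<le> \<bar>fps_nth F n\<bar> * M ^ n" for n
    by (simp add: mult_left_mono norm_power_le assms)
qed

text \<open>
  Since \<open>c\<close> has nonnegative coefficients, \<open>\<Sum>k. \<bar>F k\<bar> (\<Sum>n. c n M^n)^k\<close> dominates the double series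
  that arises on substituting \<open>c\<close> into \<open>F\<close>, which may therefore be rearranged by powers of \<open>x\<close>.  The
  series \<open>c\<close> only has to converge at \<open>M\<close>, which may be its radius of convergence.
\<close>

lemma
  fixes x :: "'b :: unital_banach_algebra"
  assumes F: "fps_conv_radius F = \<infinity>"
    and c: "fps_nth c 0 = 0" "\<And>n. 0 \<le> fps_nth c n" "fps_abs_conv c (M :: real)"
    and x: "norm x \<le> M"
  shows fps_at_compose: "fps_at F (fps_at c x) = fps_at (F oo c) x"
    and fps_abs_conv_compose: "fps_abs_conv (F oo c) M"
proof -
  \<comment> \<open>\<open>u\<close> is the double series in the algebra and \<open>w\<close> its real majorant\<close>
  define S where "S = fps_at c M"
  define u where "u = (\<lambda>k n. (fps_nth F k * fps_nth (c ^ k) n) *\<^sub>R x ^ n)"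
  define w where "w = (\<lambda>k n. \<bar>fps_nth F k\<bar> * (fps_nth (c ^ k) n * M ^ n))"
  have M: "0 \<le> M" using x norm_ge_zero order_trans by blast
  have pos: "0 \<le> fps_nth (c ^ k) n" for k n by (intro fps_power_nth_nonneg c)
  have ck: "fps_abs_conv (c ^ k) M" "fps_abs_conv (c ^ k) x" for k
    using c(3) fps_abs_conv_norm_le[OF c(3) x] by (auto intro: fps_abs_conv_power)
  have S: "(\<lambda>n. fps_nth (c ^ k) n * M ^ n) sums (S ^ k)" for k
    using fps_at_sums[OF ck(1)] fps_at_power[OF c(3)] by (simp add: S_def)
  have "0 \<le> S" unfolding S_def fps_at_def
    using c M fps_abs_conv_summable[OF c(3)] by (intro suminf_nonneg) auto
  have w: "(\<lambda>n. w k n) sums (\<bar>fps_nth F k\<bar> * S ^ k)" for k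
    unfolding w_def by (intro sums_mult S)
  have w0: "0 \<le> w k n" for k n using pos M by (simp add: w_def)
  have wsum: "(w k has_sum (\<bar>fps_nth F k\<bar> * S ^ k)) UNIV" for k
    by (rule sums_nonneg_imp_has_sum[OF w w0])
  have nu: "norm (u k n) \<le> w k n" for k n
    unfolding u_def w_def using pos
    by (simp add: abs_mult mult_left_mono norm_power_le x mult.assoc)
  have "summable (\<lambda>k. \<bar>fps_nth F k\<bar> * S ^ k)"
    using fps_abs_conv_entire[OF F, of S] \<open>0 \<le> S\<close> by (simp add: fps_abs_conv_def)
  then have Fsum: "(\<lambda>k. \<bar>fps_nth F k\<bar> * S ^ k) summable_on UNIV"
    using \<open>0 \<le> S\<close> by (intro norm_summable_imp_summable_on) simp
  have wS: "(\<lambda>(k, n). w k n) summable_on UNIV \<times> UNIV"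
  proof (rule summable_on_SigmaI)
    show "((\<lambda>n. case (k, n) of (k, n) \<Rightarrow> w k n) has_sum (\<bar>fps_nth F k\<bar> * S ^ k)) UNIV" for k
      using wsum by simp
  qed (use Fsum w0 in auto)
  have uS: "(\<lambda>(k, n). u k n) summable_on UNIV \<times> UNIV"
  proof (rule abs_summable_summable)
    show "(\<lambda>p. norm (case p of (k, n) \<Rightarrow> u k n)) summable_on UNIV \<times> UNIV"
      by (rule summable_on_comparison_test[OF wS]) (auto intro: nu)
  qed
  have us: "u k summable_on UNIV" "(u k) sums (fps_nth F k *\<^sub>R fps_at c x ^ k)" for k
  proof -
    have "summable (\<lambda>n. norm (u k n))"
      by (rule summable_comparison_test'[OF sums_summable[OF w[of k]]]) (simp add: nu)
    then show "u k summable_on UNIV" by (rule norm_summable_imp_summable_on)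
    have "fps_at c x ^ k = fps_at (c ^ k) x"
      using fps_abs_conv_norm_le[OF c(3) x] by (simp add: fps_at_power)
    then show "(u k) sums (fps_nth F k *\<^sub>R fps_at c x ^ k)"
      unfolding u_def using sums_scaleR_right[OF fps_at_sums[OF ck(2)[of k]], of "fps_nth F k"]
      by (simp add: mult_ac)
  qed
  have row: "infsum (u k) UNIV = fps_nth F k *\<^sub>R fps_at c x ^ k" for k
    using has_sum_imp_sums[OF has_sum_infsum[OF us(1)]] us(2) sums_unique2 by blast
  have col: "infsum (\<lambda>k. u k n) UNIV = fps_nth (F oo c) n *\<^sub>R x ^ n" for n
  proof -
    have "fps_nth (c ^ k) n = 0" if "n < k" for k
      using c(1) that startsby_zero_power_prefix by blast
    then have "infsum (\<lambda>k. u k n) UNIV = infsum (\<lambda>k. u k n) {0..n}"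
      by (intro infsum_cong_neutral) (auto simp: u_def not_le)
    also have "\<dots> = (\<Sum>k=0..n. u k n)" by simp
    also have "\<dots> = fps_nth (F oo c) n *\<^sub>R x ^ n"
      by (simp add: u_def fps_compose_nth scaleR_sum_left)
    finally show ?thesis .
  qed
  have "(\<lambda>(n, k). w k n) summable_on UNIV \<times> UNIV"
    using wS by (subst summable_on_swap) simp
  then have "(\<lambda>n. infsum (\<lambda>k. w k n) UNIV) summable_on UNIV"
    using summable_on_Sigma_banach[of "\<lambda>n k. w k n" UNIV "\<lambda>_. UNIV"] by simp
  then have wcols: "summable (\<lambda>n. infsum (\<lambda>k. w k n) UNIV)"
    by (rule summable_on_imp_summable)
  have wcol: "(\<lambda>k. w k n) summable_on UNIV" for n
    using summable_on_SigmaD1[of "\<lambda>n k. w k n" UNIV "\<lambda>_. UNIV" n]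
      \<open>(\<lambda>(n, k). w k n) summable_on UNIV \<times> UNIV\<close> by simp
  show "fps_abs_conv (F oo c) M"
    unfolding fps_abs_conv_def
  proof (rule summable_comparison_test'[OF wcols])
    fix n
    have "\<bar>fps_nth (F oo c) n\<bar> * M ^ n \<le> (\<Sum>k\<in>{0..n}. w k n)"
      unfolding fps_compose_nth w_def using pos M
      by (auto simp: sum_distrib_right abs_mult mult.assoc sum_nonneg
          intro!: order_trans[OF mult_right_mono[OF sum_abs]] sum_mono)
    also have "\<dots> \<le> infsum (\<lambda>k. w k n) UNIV"
      by (rule finite_sum_le_infsum[OF wcol]) (use w0 in auto)
    finally show "norm (\<bar>fps_nth (F oo c) n\<bar> * norm (M ^ n)) \<le> infsum (\<lambda>k. w k n) UNIV"
      using M by simp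
  qed
  have rows: "(\<lambda>k. infsum (u k) UNIV) summable_on UNIV"
    using summable_on_Sigma_banach[OF uS] by simp
  have "(\<lambda>(n, k). u k n) summable_on UNIV \<times> UNIV"
    using uS by (subst summable_on_swap) simp
  then have cols: "(\<lambda>n. infsum (\<lambda>k. u k n) UNIV) summable_on UNIV"
    using summable_on_Sigma_banach[of "\<lambda>n k. u k n" UNIV "\<lambda>_. UNIV"] by simp
  have "fps_at F (fps_at c x) = infsum (\<lambda>k. infsum (u k) UNIV) UNIV"
    using sums_unique[OF has_sum_imp_sums[OF has_sum_infsum[OF rows]]]
    by (simp add: row fps_at_def[of F])
  also have "\<dots> = infsum (\<lambda>n. infsum (\<lambda>k. u k n) UNIV) UNIV"
    by (rule infsum_swap_banach[OF uS])
  also have "\<dots> = fps_at (F oo c) x"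
    using sums_unique[OF has_sum_imp_sums[OF has_sum_infsum[OF cols]]]
    by (simp add: col fps_at_def[of "F oo c"])
  finally show "fps_at F (fps_at c x) = fps_at (F oo c) x" .
qed

lemma fps_at_commute:
  fixes y z :: "'b :: unital_banach_algebra"
  assumes "fps_abs_conv F y" "y * z = z * y"
  shows "fps_at F y * z = z * fps_at F y"
proof -
  have "y ^ n * z = z * y ^ n" for n
    using assms(2) by (rule power_commuting_commutes)
  then have "(\<lambda>n. fps_nth F n *\<^sub>R y ^ n * z) = (\<lambda>n. z * (fps_nth F n *\<^sub>R y ^ n))" by simp
  then have "(\<lambda>n. z * (fps_nth F n *\<^sub>R y ^ n)) sums (fps_at F y * z)"
    using bounded_linear.sums[OF bounded_linear_mult_left fps_at_sums[OF assms(1)], of z] by simp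
  moreover have "(\<lambda>n. z * (fps_nth F n *\<^sub>R y ^ n)) sums (z * fps_at F y)"
    by (intro bounded_linear.sums[OF bounded_linear_mult_right] fps_at_sums assms)
  ultimately show ?thesis by (rule sums_unique2)
qed

lemma norm_power_diff_le:
  fixes x d :: "'b :: unital_banach_algebra"
  assumes "norm x \<le> R" "norm d \<le> R"
  shows "norm (x ^ n - d ^ n) \<le> real n * R ^ (n - 1) * norm (x - d)"
proof (induction n)
  case (Suc n)
  have R: "0 \<le> R" using assms norm_ge_zero order_trans by blast
  have "x ^ Suc n - d ^ Suc n = x * (x ^ n - d ^ n) + (x - d) * d ^ n"
    by (simp add: algebra_simps)
  then have "norm (x ^ Suc n - d ^ Suc n) \<le> norm x * norm (x ^ n - d ^ n) + norm (x - d) * norm (d ^ n)"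
    by (smt (verit) norm_mult_ineq norm_triangle_ineq)
  also have "\<dots> \<le> R * (real n * R ^ (n - 1) * norm (x - d)) + norm (x - d) * R ^ n"
    using R by (intro add_mono mult_mono Suc assms norm_power_le) auto
  also have "\<dots> = real (Suc n) * R ^ (Suc n - 1) * norm (x - d)"
    by (cases n) (simp_all add: algebra_simps)
  finally show ?case .
qed simp

text \<open>
  Induction on \<open>n\<close>: if \<open>u n\<close> is the linearisation error, then
  \<open>u (n + 1) = (x^n - d^n) (x - y) + u n y + n d^(n-1) (y - d) (x - y)\<close>, where both the first and the
  last term are at most \<open>n R^(n-1) \<delta> norm (x - y)\<close>.
\<close>

lemma norm_power_diff_linear_le:
  fixes x y d :: "'b :: unital_banach_algebra"
  assumes "norm x \<le> R" "norm y \<le> R" "norm d \<le> R" "norm (x - d) \<le> \<delta>" "norm (y - d) \<le> \<delta>"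
    and comm: "x * y = y * x" "d * x = x * d" "d * y = y * d"
  shows "norm (x ^ n - y ^ n - real n *\<^sub>R (d ^ (n - 1) * (x - y)))
    \<le> real (n * (n - 1)) * R ^ (n - 2) * \<delta> * norm (x - y)"
proof (induction n)
  case (Suc n)
  have R: "0 \<le> R" and \<delta>: "0 \<le> \<delta>" using assms norm_ge_zero order_trans by blast+
  define u where "u = (\<lambda>n. x ^ n - y ^ n - real n *\<^sub>R (d ^ (n - 1) * (x - y)))"
  have yx: "y * (x - y) = (x - y) * y" using comm by (simp add: algebra_simps)
  have dd: "d * d ^ (n - 1) = d ^ n" if "0 < n" using that by (simp flip: power_Suc)
  have dy: "d ^ k * y = y * d ^ k" for k using comm(3) by (rule power_commuting_commutes)
  have eq: "u (Suc n) = (x ^ n - d ^ n) * (x - y) + u n * y + real n *\<^sub>R (d ^ (n - 1) * (y - d) * (x - y))"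
  proof (cases n)
    case (Suc k)
    have "d ^ k * d * x = d ^ k * x * d" "d ^ k * d * y = d ^ k * y * d"
      using comm by (simp_all add: mult.assoc)
    moreover have "z * (z ^ k * z) = z ^ k * (z * z)" for z :: 'b
      by (metis mult.assoc power_commutes)
    ultimately show ?thesis
      unfolding u_def Suc using comm
      by (simp add: algebra_simps scaleR_2 power_commutes[of x k, symmetric] power_commutes[of y k, symmetric]
          power_commutes[of d k, symmetric])
  qed (simp add: u_def)
  have "norm (u (Suc n)) \<le> norm (x ^ n - d ^ n) * norm (x - y) + norm (u n) * norm y
      + real n * (norm (d ^ (n - 1)) * norm (y - d) * norm (x - y))"
    unfolding eq
    by (intro norm_triangle_le add_mono) (auto intro!: mult_left_mono order_trans[OF norm_mult_ineq] mult_right_mono norm_mult_ineq)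
  also have "\<dots> \<le> (real n * R ^ (n - 1) * \<delta>) * norm (x - y)
      + (real (n * (n - 1)) * R ^ (n - 2) * \<delta> * norm (x - y)) * R
      + real n * (R ^ (n - 1) * \<delta> * norm (x - y))"
    using R \<delta> Suc
    by (intro add_mono mult_mono mult_left_mono mult_right_mono assms norm_power_le
        order_trans[OF norm_power_diff_le[OF assms(1,3)]]) (auto simp: u_def)
  also have "\<dots> = real (Suc n * (Suc n - 1)) * R ^ (Suc n - 2) * \<delta> * norm (x - y)"
  proof (cases n)
    case (Suc k)
    then show ?thesis by (cases k) (simp_all add: algebra_simps)
  qed simp
  finally show ?case by (simp add: u_def)
qed simp

text \<open>
  Summing the previous estimate: \<open>L\<close> is the second derivative, at \<open>R\<close>, of \<open>F\<close> with its coefficients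
  replaced by their absolute values.
\<close>

lemma fps_at_linear_approx:
  fixes d :: "'b :: unital_banach_algebra"
  assumes F: "fps_conv_radius F = \<infinity>"
  obtains L where "0 \<le> L" "\<And>x y \<delta>. \<lbrakk>norm x \<le> R; norm y \<le> R; norm d \<le> R; norm (x - d) \<le> \<delta>; norm (y - d) \<le> \<delta>;
      x * y = y * x; d * x = x * d; d * y = y * d\<rbrakk> \<Longrightarrow>
      norm (fps_at F x - fps_at F y - fps_at (fps_deriv F) d * (x - y)) \<le> L * \<delta> * norm (x - y)"
proof -
  define G where "G = fps_deriv (fps_deriv (Abs_fps (\<lambda>n. \<bar>fps_nth F n\<bar>)))"
  have "fps_conv_radius (Abs_fps (\<lambda>n. \<bar>fps_nth F n\<bar>)) = \<infinity>"
    using F fps_conv_radius_norm[of F] by (simp del: fps_conv_radius_norm)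
  then have "fps_conv_radius G = \<infinity>"
    unfolding G_def using fps_conv_radius_deriv[of "Abs_fps (\<lambda>n. \<bar>fps_nth F n\<bar>)"]
      fps_conv_radius_deriv[of "fps_deriv (Abs_fps (\<lambda>n. \<bar>fps_nth F n\<bar>))"] by simp
  then have "summable (\<lambda>n. norm (fps_nth G n * R ^ n))"
    by (intro norm_summable_fps) simp
  moreover define L where "L = (\<Sum>n. norm (fps_nth G n * R ^ n))"
  ultimately have "(\<lambda>n. norm (fps_nth G n * R ^ n)) sums L" by (simp add: summable_sums)
  moreover have "norm (fps_nth G n * R ^ n)
      = \<bar>fps_nth F (n + 2)\<bar> * (real ((n + 2) * (n + 2 - 1)) * \<bar>R\<bar> ^ (n + 2 - 2))" for n
  proof -
    have "fps_nth G n = real ((n + 2) * (n + 2 - 1)) * \<bar>fps_nth F (n + 2)\<bar>"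
      by (simp add: G_def algebra_simps)
    moreover have "norm (real k * \<bar>f\<bar> * R ^ n) = \<bar>f\<bar> * (real k * \<bar>R\<bar> ^ n)" for k and f :: real
      by (simp add: abs_mult power_abs)
    ultimately show ?thesis by (simp only: diff_add_inverse2)
  qed
  ultimately have "(\<lambda>n. \<bar>fps_nth F (n + 2)\<bar> * (real ((n + 2) * (n + 2 - 1)) * \<bar>R\<bar> ^ (n + 2 - 2))) sums L"
    by simp
  then have "(\<lambda>n. \<bar>fps_nth F n\<bar> * (real (n * (n - 1)) * \<bar>R\<bar> ^ (n - 2))) sums L"
    by (subst (asm) sums_iff_shift) (simp add: numeral_2_eq_2)
  note L = this
  have "0 \<le> L" by (rule sums_le[OF _ sums_zero L]) simp
  moreover have "norm (fps_at F x - fps_at F y - fps_at (fps_deriv F) d * (x - y)) \<le> L * \<delta> * norm (x - y)"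
    if *: "norm x \<le> R" "norm y \<le> R" "norm d \<le> R" "norm (x - d) \<le> \<delta>" "norm (y - d) \<le> \<delta>"
      "x * y = y * x" "d * x = x * d" "d * y = y * d" for x y \<delta>
  proof -
    have "\<bar>R\<bar> = R" using *(1) norm_ge_zero[of x] by linarith
    have F': "fps_conv_radius (fps_deriv F) = \<infinity>"
      using F fps_conv_radius_deriv[of F] by simp
    have "(\<lambda>n. (fps_nth (fps_deriv F) n *\<^sub>R d ^ n) * (x - y)) sums (fps_at (fps_deriv F) d * (x - y))"
      by (intro bounded_linear.sums[OF bounded_linear_mult_left] fps_at_sums fps_abs_conv_entire F')
    then have "(\<lambda>n. fps_nth F n *\<^sub>R (real n *\<^sub>R (d ^ (n - 1) * (x - y)))) sums (fps_at (fps_deriv F) d * (x - y))"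
      using sums_Suc[of "\<lambda>n. fps_nth F n *\<^sub>R (real n *\<^sub>R (d ^ (n - 1) * (x - y)))" "fps_at (fps_deriv F) d * (x - y)"]
      by (simp add: algebra_simps)
    then have "(\<lambda>n. fps_nth F n *\<^sub>R x ^ n - fps_nth F n *\<^sub>R y ^ n - fps_nth F n *\<^sub>R (real n *\<^sub>R (d ^ (n - 1) * (x - y))))
        sums (fps_at F x - fps_at F y - fps_at (fps_deriv F) d * (x - y))"
      by (intro sums_diff fps_at_sums fps_abs_conv_entire F)
    then have s: "(\<lambda>n. fps_nth F n *\<^sub>R (x ^ n - y ^ n - real n *\<^sub>R (d ^ (n - 1) * (x - y))))
        sums (fps_at F x - fps_at F y - fps_at (fps_deriv F) d * (x - y))"
      by (simp only: scaleR_diff_right)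
    have t: "(\<lambda>n. \<bar>fps_nth F n\<bar> * (real (n * (n - 1)) * R ^ (n - 2)) * (\<delta> * norm (x - y))) sums (L * (\<delta> * norm (x - y)))"
      using sums_mult2[OF L] \<open>\<bar>R\<bar> = R\<close> by simp
    have "norm (fps_nth F n *\<^sub>R (x ^ n - y ^ n - real n *\<^sub>R (d ^ (n - 1) * (x - y))))
        \<le> \<bar>fps_nth F n\<bar> * (real (n * (n - 1)) * R ^ (n - 2)) * (\<delta> * norm (x - y))" for n
      using mult_left_mono[OF norm_power_diff_linear_le[OF *, of n], of "\<bar>fps_nth F n\<bar>"]
      by (simp add: mult.assoc)
    from norm_sums_le[OF s t this] show ?thesis by (simp add: mult.assoc)
  qed
  ultimately show ?thesis by (rule that)
qed

text \<open>
  If \<open>F x = F y\<close>, then \<open>F' d (x - y)\<close> equals the linearisation error, whose norm is at most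
  \<open>L \<delta> norm (x - y)\<close>; multiplying by the inverse \<open>e\<close> of \<open>F' d\<close> gives
  \<open>norm (x - y) \<le> norm (x - y) / 2\<close> for small \<open>\<delta>\<close>.
\<close>

lemma fps_at_locally_injective:
  fixes d e :: "'b :: unital_banach_algebra"
  assumes F: "fps_conv_radius F = \<infinity>" and e: "e * fps_at (fps_deriv F) d = 1"
  obtains \<delta> where "0 < \<delta>" "\<And>x y. \<lbrakk>norm (x - d) < \<delta>; norm (y - d) < \<delta>;
      x * y = y * x; d * x = x * d; d * y = y * d; fps_at F x = fps_at F y\<rbrakk> \<Longrightarrow> x = y"
proof -
  define R where "R = norm d + 1"
  obtain L where L: "0 \<le> L" "\<And>x y \<delta>. \<lbrakk>norm x \<le> R; norm y \<le> R; norm d \<le> R; norm (x - d) \<le> \<delta>; norm (y - d) \<le> \<delta>;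
      x * y = y * x; d * x = x * d; d * y = y * d\<rbrakk> \<Longrightarrow>
      norm (fps_at F x - fps_at F y - fps_at (fps_deriv F) d * (x - y)) \<le> L * \<delta> * norm (x - y)"
    using fps_at_linear_approx[OF F] by metis
  define \<delta> where "\<delta> = min 1 (1 / (2 * (norm e * L + 1)))"
  have pos: "0 < norm e * L + 1" using L(1) by (simp add: add_nonneg_pos)
  then have \<delta>: "0 < \<delta>" "\<delta> \<le> 1" "\<delta> * (norm e * L + 1) \<le> 1 / 2"
    by (auto simp: \<delta>_def min_def field_simps)
  have "x = y" if *: "norm (x - d) < \<delta>" "norm (y - d) < \<delta>"
      "x * y = y * x" "d * x = x * d" "d * y = y * d" "fps_at F x = fps_at F y" for x y
  proof -
    have "norm x \<le> R" "norm y \<le> R" "norm d \<le> R"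
      using *(1,2) \<delta>(2) norm_triangle_sub[of x d] norm_triangle_sub[of y d] by (auto simp: R_def)
    then have "norm (fps_at (fps_deriv F) d * (x - y)) \<le> L * \<delta> * norm (x - y)"
      using L(2)[of x y \<delta>] * by simp
    moreover have "x - y = e * (fps_at (fps_deriv F) d * (x - y))"
      by (simp add: mult.assoc[symmetric] e)
    then have "norm (x - y) \<le> norm e * norm (fps_at (fps_deriv F) d * (x - y))"
      by (metis norm_mult_ineq)
    ultimately have "norm (x - y) \<le> norm e * (L * \<delta> * norm (x - y))"
      by (meson mult_left_mono norm_ge_zero order_trans)
    also have "\<dots> \<le> \<delta> * (norm e * L + 1) * norm (x - y)"
      using \<delta> by (simp add: algebra_simps)
    also have "\<dots> \<le> 1 / 2 * norm (x - y)"
      using \<delta> by (intro mult_right_mono) auto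
    finally show ?thesis by simp
  qed
  with \<delta>(1) show ?thesis by (rule that)
qed

lemma continuous_on_fps_at_comp:
  fixes B :: "real \<Rightarrow> 'b :: unital_banach_algebra"
  assumes B: "continuous_on S B" "\<And>t. t \<in> S \<Longrightarrow> norm (B t) \<le> M" and F: "fps_abs_conv F (M :: real)"
  shows "continuous_on S (\<lambda>t. fps_at F (B t))"
proof (cases "S = {}")
  case False
  then have M: "0 \<le> M" using B(2) norm_ge_zero order_trans by blast
  have "uniform_limit S (\<lambda>n t. \<Sum>i<n. fps_nth F i *\<^sub>R B t ^ i) (\<lambda>t. fps_at F (B t)) sequentially"
    unfolding fps_at_def
  proof (rule Weierstrass_m_test)
    show "norm (fps_nth F n *\<^sub>R B t ^ n) \<le> \<bar>fps_nth F n\<bar> * M ^ n" if "t \<in> S" for n t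
      using norm_power_le[OF B(2)[OF that]] by (simp add: mult_left_mono)
    show "summable (\<lambda>n. \<bar>fps_nth F n\<bar> * M ^ n)"
      using F M by (simp add: fps_abs_conv_def)
  qed
  then show ?thesis
    by (rule uniform_limit_theorem[rotated])
      (auto intro!: always_eventually continuous_intros B(1))
qed simp


section \<open>Entire functions whose local inverse has nonnegative coefficients\<close>

text \<open>
  For series that solve a differential equation: the right-hand side expresses the \<open>n\<close>-th coefficient
  of the derivative by coefficients of index at most \<open>n\<close>.
\<close>

lemma fps_nonneg_by_deriv:
  fixes F :: "real fps"
  assumes "0 \<le> fps_nth F 0"
    and "\<And>n. (\<And>i. i \<le> n \<Longrightarrow> 0 \<le> fps_nth F i) \<Longrightarrow> 0 \<le> fps_nth (fps_deriv F) n"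
  shows "0 \<le> fps_nth F n"
proof (induction n rule: less_induct)
  case (less n)
  show ?case
  proof (cases n)
    case (Suc k)
    then have "0 \<le> real (Suc k) * fps_nth F (Suc k)" using assms(2)[of k] less by simp
    then show ?thesis using Suc by (simp add: zero_le_mult_iff)
  qed (use assms in simp)
qed

lemma fps_at_nonneg:
  fixes x :: real
  assumes "fps_abs_conv F x" "\<And>n. 0 \<le> fps_nth F n" "0 \<le> x"
  shows "(\<Sum>n<N. fps_nth F n * x ^ n) \<le> fps_at F x"
  unfolding fps_at_def using assms fps_abs_conv_summable[OF assms(1)]
  by (simp add: sum_le_suminf)

text \<open>
  The series \<open>h\<close> is the reciprocal of \<open>F'\<close>; its convergence up to \<open>t0\<close> makes \<open>F\<close> increase on
  \<open>[0, t0]\<close>.  In the applications \<open>t0\<close> is the first zero of \<open>F'\<close>.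
\<close>

locale entire_with_positive_inverse =
  fixes F h :: "real fps" and t0 :: real
  assumes F: "fps_conv_radius F = \<infinity>" "fps_nth F 0 = 0" "0 < fps_nth F 1"
    and t0: "0 < t0"
    and h_inv: "h * fps_deriv F = 1"
    and h_nonneg: "\<And>n. 0 \<le> fps_nth h n"
    and h_conv: "ereal t0 \<le> fps_conv_radius h"
begin

definition c :: "real fps" where "c = fps_inv F"

lemma compositional_inverse_nth_0: "fps_nth c 0 = 0"
  by (simp add: c_def fps_inv_def)

lemma compositional_inverse: "F oo c = fps_X"
  unfolding c_def using F by (intro fps_inv_right) auto

lemma compositional_inverse_deriv: "fps_deriv c = h oo c"
proof -
  have 1: "(fps_deriv F oo c) * fps_deriv c = 1"
    using fps_compose_deriv[OF compositional_inverse_nth_0, of F]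
    by (simp add: compositional_inverse)
  have "(h oo c) * (fps_deriv F oo c) = 1"
    using fps_compose_mult_distrib[OF compositional_inverse_nth_0, of h "fps_deriv F"]
    by (simp add: h_inv)
  then show ?thesis
    using 1 by (metis mult.assoc mult.commute mult_1)
qed

text \<open>
  In \<open>c' = h \<circ> c\<close> the \<open>n\<close>-th coefficient of the right-hand side is a polynomial with nonnegative
  coefficients in \<open>c 0, ..., c n\<close>.
\<close>

lemma compositional_inverse_nonneg: "0 \<le> fps_nth c n"
proof (rule fps_nonneg_by_deriv)
  show "0 \<le> fps_nth c 0" by (simp add: compositional_inverse_nth_0)
  show "0 \<le> fps_nth (fps_deriv c) n" if "\<And>i. i \<le> n \<Longrightarrow> 0 \<le> fps_nth c i" for n
    unfolding compositional_inverse_deriv fps_compose_nth using that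
    by (intro sum_nonneg mult_nonneg_nonneg h_nonneg fps_power_nth_nonneg) auto
qed

lemma compositional_inverse_nth_1: "0 < fps_nth c 1"
proof -
  have "fps_nth (h * fps_deriv F) 0 = 1" by (simp add: h_inv)
  then have "fps_nth h 0 * fps_nth F 1 = 1" by simp
  then have "fps_nth h 0 \<noteq> 0" by auto
  then have "0 < fps_nth h 0" using h_nonneg[of 0] by simp
  then show ?thesis using arg_cong[OF compositional_inverse_deriv, of "\<lambda>G. fps_nth G 0"] by simp
qed

lemma deriv_conv: "fps_conv_radius (fps_deriv F) = \<infinity>"
  using fps_conv_radius_deriv[of F] F by simp

lemma deriv_times_reciprocal:
  assumes "0 \<le> y" "y < t0"
  shows "eval_fps (fps_deriv F) y * eval_fps h y = 1" "fps_abs_conv h y"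
    "0 < eval_fps (fps_deriv F) y"
proof -
  have y: "ereal (norm y) < fps_conv_radius h"
    using assms h_conv by (intro less_le_trans[OF _ h_conv]) auto
  then show eq: "eval_fps (fps_deriv F) y * eval_fps h y = 1"
    using eval_fps_mult[of y h "fps_deriv F"] deriv_conv h_inv by (simp add: mult.commute)
  show conv: "fps_abs_conv h y"
    using y assms by (intro fps_abs_conv_bounded_powers[where K = 1 and b = y]) auto
  have "0 \<le> eval_fps h y"
    using fps_at_nonneg[OF conv h_nonneg assms(1), of 0] by (simp add: fps_at_real)
  with eq show "0 < eval_fps (fps_deriv F) y"
    using zero_less_mult_iff[of "eval_fps (fps_deriv F) y" "eval_fps h y"] by auto
qed

lemma critical_value_pos: "0 < eval_fps F t0"
proof -
  have "eval_fps F 0 < eval_fps F t0"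
  proof (rule DERIV_pos_imp_increasing_open[OF t0])
    show "\<exists>y. (eval_fps F has_real_derivative y) (at x) \<and> 0 < y" if "0 < x" "x < t0" for x
      using that F deriv_times_reciprocal[of x]
      by (intro exI[of _ "eval_fps (fps_deriv F) x"] conjI has_field_derivative_eval_fps) auto
    show "continuous_on {0..t0} (eval_fps F)"
      using F continuous_on_subset[OF continuous_on_eval_fps[of F]] by auto
  qed
  then show ?thesis using F by (simp add: eval_fps_at_0)
qed

text \<open>
  A partial sum \<open>P\<close> of \<open>c\<close> is a subsolution of the equation for \<open>c\<close>, that is \<open>P' \<le> h \<circ> P\<close>, so
  \<open>(F \<circ> P)' \<le> 1\<close> and \<open>F (P w) \<le> w\<close> as long as \<open>P\<close> stays below \<open>t0\<close>.  If \<open>P\<close> reached \<open>t0\<close> at some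
  \<open>w < F t0\<close>, this would give \<open>F t0 \<le> w\<close>.
\<close>

lemma partial_sum_le_critical_point:
  "(\<Sum>n<N. fps_nth c n * eval_fps F t0 ^ n) \<le> t0"
proof (rule ccontr)
  define M where "M = eval_fps F t0"
  define q where "q = fps_cutoff N c"
  define P where "P = (\<lambda>w. \<Sum>n<N. fps_nth c n * w ^ n)"
  assume "\<not> (\<Sum>n<N. fps_nth c n * eval_fps F t0 ^ n) \<le> t0"
  then have PM: "t0 < P M" by (simp add: P_def M_def)
  have M: "0 < M" using critical_value_pos by (simp add: M_def)
  have q_conv: "fps_conv_radius q = \<infinity>"
  proof -
    have "conv_radius (fps_nth q) = conv_radius (\<lambda>_. 0 :: real)"
      by (intro conv_radius_cong' eventually_sequentiallyI[of N]) (simp add: q_def)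
    then show ?thesis by (simp add: fps_conv_radius_def)
  qed
  have P_q: "P w = eval_fps q w" for w
  proof -
    have "(\<Sum>n. fps_nth q n * w ^ n) = (\<Sum>n<N. fps_nth q n * w ^ n)"
      by (intro suminf_finite) (auto simp: q_def)
    then show ?thesis by (simp add: P_def eval_fps_def q_def)
  qed
  have P_cont: "continuous_on S P" for S
    unfolding P_def by (intro continuous_intros)
  have P0: "P 0 = 0"
    using compositional_inverse_nth_0
    by (auto simp: P_def power_0_left intro!: sum.neutral split: if_splits)
  have P_deriv: "(P has_real_derivative (\<Sum>n<N - 1. fps_nth (h oo c) n * w ^ n)) (at w)" for w
  proof -
    have "(P has_real_derivative eval_fps (fps_deriv q) w) (at w)"
      unfolding P_q[abs_def] using q_conv by (intro has_field_derivative_eval_fps) auto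
    moreover have "eval_fps (fps_deriv q) w = (\<Sum>n<N - 1. fps_nth (fps_deriv q) n * w ^ n)"
      unfolding eval_fps_def by (intro suminf_finite) (auto simp: q_def)
    moreover have "\<dots> = (\<Sum>n<N - 1. fps_nth (fps_deriv c) n * w ^ n)"
      by (intro sum.cong) (auto simp: q_def)
    ultimately show ?thesis by (simp only: compositional_inverse_deriv)
  qed
  have q_pow: "fps_nth (q ^ i) n = fps_nth (c ^ i) n" if "n < N" for i n
    using that
  proof (induction i arbitrary: n)
    case (Suc i)
    then show ?case by (auto simp: fps_mult_nth q_def intro!: sum.cong)
  qed simp
  \<comment> \<open>\<open>P' \<le> h \<circ> P\<close>, since the truncation only drops nonnegative terms\<close>
  have P'_le: "(\<Sum>n<N - 1. fps_nth (h oo c) n * w ^ n) \<le> eval_fps h (P w)"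
    if "0 \<le> w" "0 \<le> P w" "P w < t0" for w
  proof -
    have "(\<Sum>n<N - 1. fps_nth (h oo c) n * w ^ n)
        = (\<Sum>n<N - 1. \<Sum>i\<le>n. fps_nth h i * (fps_nth (q ^ i) n * w ^ n))"
      by (intro sum.cong) (auto simp: fps_compose_nth sum_distrib_right q_pow atLeast0AtMost mult.assoc)
    also have "\<dots> \<le> (\<Sum>n<N - 1. \<Sum>i<N. fps_nth h i * (fps_nth (q ^ i) n * w ^ n))"
      using that compositional_inverse_nonneg
      by (intro sum_mono sum_mono2 mult_nonneg_nonneg h_nonneg fps_power_nth_nonneg) (auto simp: q_def)
    also have "\<dots> = (\<Sum>i<N. fps_nth h i * (\<Sum>n<N - 1. fps_nth (q ^ i) n * w ^ n))"
      by (subst sum.swap) (simp add: sum_distrib_left)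
    also have "\<dots> \<le> (\<Sum>i<N. fps_nth h i * P w ^ i)"
    proof (intro sum_mono mult_left_mono h_nonneg)
      fix i
      have conv: "fps_abs_conv q w" by (rule fps_abs_conv_entire[OF q_conv])
      have "(\<Sum>n<N - 1. fps_nth (q ^ i) n * w ^ n) \<le> fps_at (q ^ i) w"
        using that compositional_inverse_nonneg
        by (intro fps_at_nonneg fps_abs_conv_power conv fps_power_nth_nonneg) (auto simp: q_def)
      also have "\<dots> = P w ^ i"
        using fps_at_power[OF conv, of i] by (simp add: P_q fps_at_real)
      finally show "(\<Sum>n<N - 1. fps_nth (q ^ i) n * w ^ n) \<le> P w ^ i" .
    qed
    also have "\<dots> \<le> eval_fps h (P w)"
      using fps_at_nonneg[OF deriv_times_reciprocal(2)[OF that(2,3)] h_nonneg that(2)]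
      by (simp add: fps_at_real)
    finally show ?thesis .
  qed
  have P_nonneg: "0 \<le> P w" if "0 \<le> w" for w
    unfolding P_def using that by (intro sum_nonneg mult_nonneg_nonneg compositional_inverse_nonneg) auto
  obtain w1 where w1: "0 \<le> w1" "w1 \<le> M" "P w1 = t0"
    using IVT'[of P 0 t0 M] PM P0 t0 M P_cont by auto
  have "w1 < M" using w1 PM by (cases "w1 = M") auto
  have N: "2 \<le> N"
  proof (rule ccontr)
    assume "\<not> 2 \<le> N"
    then have "{..<N} \<subseteq> {0}" by auto
    then have "P w1 = 0"
      unfolding P_def using compositional_inverse_nth_0 by (intro sum.neutral) auto
    then show False using w1 t0 by simp
  qed
  have P_less: "P w < t0" if "0 \<le> w" "w < w1" for w
  proof -
    have "P w < P w1"
      unfolding P_def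
    proof (rule sum_strict_mono_ex1)
      show "\<forall>n\<in>{..<N}. fps_nth c n * w ^ n \<le> fps_nth c n * w1 ^ n"
        using that by (auto intro!: mult_left_mono power_mono compositional_inverse_nonneg)
      show "\<exists>n\<in>{..<N}. fps_nth c n * w ^ n < fps_nth c n * w1 ^ n"
        using N that compositional_inverse_nth_1 by (intro bexI[of _ 1]) auto
    qed simp
    then show ?thesis using w1 by simp
  qed
  \<comment> \<open>hence \<open>F \<circ> P\<close> grows at most at unit speed up to the first time \<open>w1\<close> at which \<open>P\<close> reaches \<open>t0\<close>\<close>
  have "eval_fps F (P w1) - w1 \<le> eval_fps F (P 0) - 0"
  proof (rule DERIV_nonpos_imp_decreasing_open[OF w1(1)])
    fix w assume w: "0 < w" "w < w1"
    define D where "D = (\<Sum>n<N - 1. fps_nth (h oo c) n * w ^ n)"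
    have y: "0 \<le> P w" "P w < t0" using w P_nonneg P_less by auto
    have "((\<lambda>w. eval_fps F (P w) - w) has_real_derivative eval_fps (fps_deriv F) (P w) * D - 1) (at w)"
      unfolding D_def using F
      by (intro DERIV_diff DERIV_ident DERIV_chain2[OF _ P_deriv] has_field_derivative_eval_fps) auto
    moreover have "eval_fps (fps_deriv F) (P w) * D \<le> eval_fps (fps_deriv F) (P w) * eval_fps h (P w)"
      unfolding D_def using w y deriv_times_reciprocal(3)[OF y]
      by (intro mult_left_mono P'_le) auto
    ultimately show "\<exists>y. ((\<lambda>w. eval_fps F (P w) - w) has_real_derivative y) (at w) \<and> y \<le> 0"
      using deriv_times_reciprocal(1)[OF y] by auto
  next
    show "continuous_on {0..w1} (\<lambda>w. eval_fps F (P w) - w)"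
      using F by (intro continuous_on_diff continuous_on_id continuous_on_compose2[OF continuous_on_eval_fps P_cont]) auto
  qed
  then have "M \<le> w1" using F by (simp add: w1 P0 eval_fps_at_0 M_def)
  then show False using \<open>w1 < M\<close> by simp
qed

text \<open>
  Nonnegative terms with partial sums bounded by \<open>t0\<close> converge, even at the endpoint \<open>F t0\<close>, and the
  sum is strictly smaller before the endpoint because \<open>c 1 > 0\<close>.
\<close>

lemma compositional_inverse_conv:
  assumes "0 \<le> m" "m \<le> eval_fps F t0"
  shows "fps_abs_conv c m" "fps_at c m \<le> t0" "m < eval_fps F t0 \<Longrightarrow> fps_at c m < t0"
proof -
  define M where "M = eval_fps F t0"
  have M: "0 < M" using critical_value_pos by (simp add: M_def)
  have "summable (\<lambda>n. fps_nth c n * M ^ n)"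
    using partial_sum_le_critical_point M compositional_inverse_nonneg
    by (intro summableI_nonneg_bounded[where x = t0]) (auto simp: M_def)
  then have conv: "fps_abs_conv c M"
    using compositional_inverse_nonneg M by (simp add: fps_abs_conv_def)
  have "fps_at c M \<le> t0"
    unfolding fps_at_def using partial_sum_le_critical_point fps_abs_conv_summable[OF conv]
    by (intro suminf_le_const) (auto simp: M_def)
  show conv': "fps_abs_conv c m"
    by (rule fps_abs_conv_norm_le[OF conv]) (use assms in \<open>auto simp: M_def\<close>)
  have le: "fps_nth c n *\<^sub>R m ^ n \<le> fps_nth c n *\<^sub>R M ^ n" for n
    using assms by (simp add: M_def mult_left_mono power_mono compositional_inverse_nonneg)
  then have "fps_at c m \<le> fps_at c M"
    by (rule sums_le[OF _ fps_at_sums[OF conv'] fps_at_sums[OF conv]])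
  with \<open>fps_at c M \<le> t0\<close> show "fps_at c m \<le> t0" by simp
  assume "m < eval_fps F t0"
  then have "fps_nth c 1 * m < fps_nth c 1 * M"
    using compositional_inverse_nth_1 by (simp add: M_def)
  then have pos: "0 < fps_nth c 1 *\<^sub>R M ^ 1 - fps_nth c 1 *\<^sub>R m ^ 1" by simp
  have diff: "(\<lambda>n. fps_nth c n *\<^sub>R M ^ n - fps_nth c n *\<^sub>R m ^ n) sums (fps_at c M - fps_at c m)"
    by (intro sums_diff fps_at_sums conv conv')
  have "0 < (\<Sum>n. fps_nth c n *\<^sub>R M ^ n - fps_nth c n *\<^sub>R m ^ n)"
    by (rule suminf_pos2[OF sums_summable[OF diff] _ pos]) (use le in auto)
  then have "fps_at c m < fps_at c M"
    using sums_unique[OF diff] by simp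
  with \<open>fps_at c M \<le> t0\<close> show "fps_at c m < t0" by simp
qed

end

section \<open>The norm estimate\<close>

text \<open>
  With \<open>C t\<close> for the inverse series evaluated at \<open>F (t x)\<close>, the set of \<open>t\<close> with \<open>C t = t x\<close> is open
  and closed in \<open>[0, \<tau>)\<close>: always \<open>F (C t) = F (t x)\<close>, and \<open>F\<close> is injective near a point where
  \<open>C s = s x\<close>, as \<open>h (s x)\<close> inverts \<open>F' (s x)\<close>.  The bound is then the triangle inequality for \<open>C t\<close>.
\<close>

lemma (in entire_with_positive_inverse) norm_le_compositional_inverse:
  fixes x :: "'b :: unital_banach_algebra"
  assumes m: "m \<le> eval_fps F t0" "\<And>t. 0 < t \<Longrightarrow> norm (fps_at F (t *\<^sub>R x)) \<le> m"
    and hx: "\<And>t. 0 \<le> t \<Longrightarrow> t < \<tau> \<Longrightarrow> fps_abs_conv h (t *\<^sub>R x)"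
    and t: "0 < t" "t < \<tau>"
  shows "t * norm x \<le> fps_at c m"
proof -
  have m0: "0 \<le> m" by (rule order_trans[OF norm_ge_zero m(2)[of 1]]) simp
  have cm: "fps_abs_conv c m" by (rule compositional_inverse_conv(1)[OF m0 m(1)])
  have c0: "fps_nth c 0 = 0" by (rule compositional_inverse_nth_0)
  have c_nonneg: "0 \<le> fps_nth c n" for n by (rule compositional_inverse_nonneg)
  define B where "B = (\<lambda>t. fps_at F (t *\<^sub>R x))"
  define C where "C = (\<lambda>t. fps_at c (B t))"
  have fps_at_0: "fps_at G (0 :: 'b) = fps_nth G 0 *\<^sub>R 1" for G
  proof -
    have "fps_nth G n *\<^sub>R (0 :: 'b) ^ n = (if n = 0 then fps_nth G 0 *\<^sub>R 1 else 0)" for n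
      by (cases n) auto
    then show ?thesis
      unfolding fps_at_def using sums_unique[OF sums_single[of 0 "\<lambda>_. fps_nth G 0 *\<^sub>R (1 :: 'b)"]] by simp
  qed
  have Bm: "norm (B t) \<le> m" if "0 \<le> t" for t
    using that m(2)[of t] m0 F(2) by (cases "t = 0") (auto simp: B_def fps_at_0)
  have Bconv: "fps_abs_conv c (B t)" if "0 \<le> t" for t
    by (rule fps_abs_conv_norm_le[OF cm Bm[OF that]])
  have FC: "fps_at F (C t) = B t" if "0 \<le> t" for t
    unfolding C_def using fps_at_compose[OF F(1) c0 c_nonneg cm Bm[OF that]]
    by (simp add: compositional_inverse fps_at_X)
  have B_commute: "B t * x = x * B t" for t
    unfolding B_def by (intro fps_at_commute fps_abs_conv_entire F) simp
  have C_commute: "C t * (s *\<^sub>R x) = (s *\<^sub>R x) * C t" if "0 \<le> t" for s t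
    unfolding C_def by (intro fps_at_commute Bconv that) (simp add: B_commute)
  have B_cont: "continuous_on {0..<\<tau>} B"
    unfolding B_def
  proof (rule continuous_on_fps_at_comp)
    show "norm (t *\<^sub>R x) \<le> \<tau> * norm x" if "t \<in> {0..<\<tau>}" for t
      using that by (auto intro!: mult_right_mono)
  qed (intro continuous_intros fps_abs_conv_entire F)+
  have C_cont: "continuous_on {0..<\<tau>} C"
    unfolding C_def using Bm by (intro continuous_on_fps_at_comp[OF B_cont _ cm]) auto
  define E where "E = {t \<in> {0..<\<tau>}. C t - t *\<^sub>R x = 0}"
  have closed: "closedin (top_of_set {0..<\<tau>}) E"
    unfolding E_def by (intro continuous_closedin_preimage_constant continuous_intros C_cont)
  have opn: "openin (top_of_set {0..<\<tau>}) E"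
    unfolding openin_contains_ball
  proof (intro conjI ballI)
    show "E \<subseteq> {0..<\<tau>}" by (auto simp: E_def)
    fix s assume "s \<in> E"
    then have s: "0 \<le> s" "s < \<tau>" "C s = s *\<^sub>R x" by (auto simp: E_def)
    have "fps_at h (s *\<^sub>R x) * fps_at (fps_deriv F) (s *\<^sub>R x) = fps_at (h * fps_deriv F) (s *\<^sub>R x)"
      using fps_conv_radius_deriv[of F] F(1)
      by (intro fps_at_mult[symmetric] hx s fps_abs_conv_entire) auto
    then have "fps_at h (s *\<^sub>R x) * fps_at (fps_deriv F) (s *\<^sub>R x) = 1"
      by (simp add: h_inv fps_at_1)
    then obtain \<delta> where \<delta>: "0 < \<delta>" "\<And>y z. \<lbrakk>norm (y - s *\<^sub>R x) < \<delta>; norm (z - s *\<^sub>R x) < \<delta>;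
      y * z = z * y; (s *\<^sub>R x) * y = y * (s *\<^sub>R x); (s *\<^sub>R x) * z = z * (s *\<^sub>R x);
      fps_at F y = fps_at F z\<rbrakk> \<Longrightarrow> y = z"
      by (rule fps_at_locally_injective[OF F(1)]) blast
    have "continuous_on {0..<\<tau>} (\<lambda>t. t *\<^sub>R x)" by (intro continuous_intros)
    then obtain d1 where d1: "0 < d1" "\<And>t. t \<in> {0..<\<tau>} \<Longrightarrow> dist t s < d1 \<Longrightarrow> dist (t *\<^sub>R x) (s *\<^sub>R x) < \<delta>"
      using \<delta>(1) s unfolding continuous_on_iff by (metis atLeastLessThan_iff)
    obtain d2 where d2: "0 < d2" "\<And>t. t \<in> {0..<\<tau>} \<Longrightarrow> dist t s < d2 \<Longrightarrow> dist (C t) (C s) < \<delta>"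
      using C_cont \<delta>(1) s unfolding continuous_on_iff by (metis atLeastLessThan_iff)
    have "ball s (min d1 d2) \<inter> {0..<\<tau>} \<subseteq> E"
    proof
      fix t assume t: "t \<in> ball s (min d1 d2) \<inter> {0..<\<tau>}"
      then have t': "dist t s < d1" "dist t s < d2" "0 \<le> t" by (auto simp: dist_commute)
      have "C t = t *\<^sub>R x"
      proof (rule \<delta>(2))
        show "norm (C t - s *\<^sub>R x) < \<delta>" "norm (t *\<^sub>R x - s *\<^sub>R x) < \<delta>"
          using d1(2)[of t] d2(2)[of t] t s t' by (auto simp: dist_norm)
        show "C t * (t *\<^sub>R x) = (t *\<^sub>R x) * C t" "(s *\<^sub>R x) * C t = C t * (s *\<^sub>R x)"
          using C_commute[OF t'(3)] by metis+
        show "(s *\<^sub>R x) * (t *\<^sub>R x) = (t *\<^sub>R x) * (s *\<^sub>R x)" by (simp add: mult.commute)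
        show "fps_at F (C t) = fps_at F (t *\<^sub>R x)" using FC[OF t'(3)] by (simp add: B_def)
      qed
      then show "t \<in> E" using t by (auto simp: E_def)
    qed
    then show "\<exists>\<epsilon>>0. ball s \<epsilon> \<inter> {0..<\<tau>} \<subseteq> E"
      using d1(1) d2(1) by (intro exI[of _ "min d1 d2"]) auto
  qed
  have "0 \<in> E"
    using t F(2) by (simp add: E_def C_def B_def fps_at_0 c0)
  moreover have "E = {} \<or> E = {0..<\<tau>}"
    using connected_clopen[THEN iffD1, OF connected_Ico[of 0 \<tau>], THEN spec, THEN mp, OF conjI[OF opn closed]] .
  ultimately have "E = {0..<\<tau>}" by blast
  with t have "t \<in> E" by simp
  then have Ct: "C t = t *\<^sub>R x" by (simp add: E_def)
  have "norm (C t) \<le> fps_at c m"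
  proof (rule norm_sums_le)
    show "(\<lambda>n. fps_nth c n *\<^sub>R B t ^ n) sums C t"
      unfolding C_def using t by (intro fps_at_sums Bconv) auto
    show "(\<lambda>n. fps_nth c n *\<^sub>R m ^ n) sums fps_at c m" by (rule fps_at_sums[OF cm])
    show "norm (fps_nth c n *\<^sub>R B t ^ n) \<le> fps_nth c n *\<^sub>R m ^ n" for n
      using norm_power_le[OF Bm[of t]] t c_nonneg by (simp add: mult_left_mono)
  qed
  then show ?thesis using t Ct by simp
qed

section \<open>Growth of powers outside the spectrum\<close>

class complex_banach_algebra = cbanach + unital_banach_algebra +
  assumes scaleC_mult_left: "(a *\<^sub>C x) * y = a *\<^sub>C (x * y)"
    and mult_scaleC_right: "x * (a *\<^sub>C y) = a *\<^sub>C (x * y)"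

lemma bounded_linear_scaleC_left:
  "bounded_linear (\<lambda>a. a *\<^sub>C (x :: 'b :: complex_normed_vector))"
proof (rule bounded_linear_intro[where K = "norm x"])
  show "(r *\<^sub>R a) *\<^sub>C x = r *\<^sub>R a *\<^sub>C x" for r a
    by (simp add: scaleR_scaleC scaleC_scaleC scaleR_conv_of_real)
qed (simp_all add: scaleC_add_left norm_scaleC mult.commute)

lemmas scaleC_simps =
  linear_0[OF bounded_linear.linear[OF bounded_linear_scaleC]]
  linear_diff[OF bounded_linear.linear[OF bounded_linear_scaleC]]
  linear_0[OF bounded_linear.linear[OF bounded_linear_scaleC_left]]
  linear_diff[OF bounded_linear.linear[OF bounded_linear_scaleC_left]]

lemma scaleC_power:
  fixes x :: "'b :: complex_banach_algebra"
  shows "(a *\<^sub>C x) ^ n = a ^ n *\<^sub>C x ^ n"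
  by (induction n) (simp_all add: scaleC_one scaleC_mult_left mult_scaleC_right scaleC_scaleC power_commutes)

lemma sum_powers_times_one_minus:
  fixes y :: "'b :: unital_banach_algebra"
  shows "(\<Sum>k<n. y ^ k) * (1 - y) = 1 - y ^ n"
proof (induction n)
  case (Suc n)
  have "((\<Sum>k<n. y ^ k) + y ^ n) * (1 - y) = (\<Sum>k<n. y ^ k) * (1 - y) + (y ^ n - y ^ Suc n)"
    by (simp add: distrib_right right_diff_distrib power_commutes)
  then show ?case by (simp only: sum.lessThan_Suc Suc) simp
qed simp

lemma sum_unity_root_powers:
  fixes k n :: nat
  defines "\<omega> \<equiv> exp (2 * of_real pi * \<i> / of_nat n :: complex)"
  assumes "k < n"
  shows "(\<Sum>j<n. (\<omega> ^ j) ^ k) = (if k = 0 then of_nat n else 0)"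
proof (cases "k = 0")
  case False
  have "\<omega> ^ k = exp (2 * of_real pi * \<i> * of_nat k / of_nat n)"
    unfolding \<omega>_def by (simp flip: exp_of_nat_mult add: mult_ac)
  then have "\<omega> ^ k \<noteq> 1" "(\<omega> ^ k) ^ n = 1"
    using complex_root_unity_eq_1[of n k] complex_root_unity[of n k] assms False
    by (auto dest: dvd_imp_le)
  then have "(\<Sum>j<n. (\<omega> ^ k) ^ j) = 0"
    by (simp add: geometric_sum)
  then show ?thesis using False by (simp add: mult.commute flip: power_mult)
qed simp

text \<open>
  The inverse of \<open>1 - u x\<close> is Lipschitz on the disc \<open>cmod u \<le> q\<close>: by the resolvent identity
  \<open>V u - V v = (u - v) V u x V v\<close> it is continuous, so it is bounded on the compact disc, and the
  identity turns the bound into a Lipschitz constant.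
\<close>

lemma inverse_one_minus_scaleC_lipschitz:
  fixes x :: "'b :: complex_banach_algebra"
  assumes b: "0 < b" and q_def: "q = 1 / b"
    and inv: "\<And>z. b \<le> cmod z \<Longrightarrow> \<exists>y. (z *\<^sub>C 1 - x) * y = 1 \<and> y * (z *\<^sub>C 1 - x) = 1"
  obtains V B L where "0 < L"
    "\<And>u. cmod u \<le> q \<Longrightarrow> (1 - u *\<^sub>C x) * V u = 1"
    "\<And>u. cmod u \<le> q \<Longrightarrow> norm (V u) \<le> B"
    "\<And>u v. cmod u \<le> q \<Longrightarrow> cmod v \<le> q \<Longrightarrow> norm (V u - V v) \<le> L * cmod (u - v)"
proof -
  have "\<exists>y. (1 - u *\<^sub>C x) * y = 1 \<and> y * (1 - u *\<^sub>C x) = 1" if u: "cmod u \<le> q" for u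
  proof (cases "u = 0")
    case True
    then show ?thesis by (simp add: scaleC_simps)
  next
    case False
    then have "b \<le> cmod (1 / u)" using u b by (simp add: q_def norm_divide field_simps)
    then obtain y where y: "((1 / u) *\<^sub>C 1 - x) * y = 1" "y * ((1 / u) *\<^sub>C 1 - x) = 1"
      using inv by blast
    have eq: "1 - u *\<^sub>C x = u *\<^sub>C ((1 / u) *\<^sub>C 1 - x)"
      using False by (simp add: scaleC_simps scaleC_scaleC scaleC_one)
    show ?thesis
      by (intro exI[of _ "(1 / u) *\<^sub>C y"])
        (simp add: eq scaleC_mult_left mult_scaleC_right scaleC_scaleC y False scaleC_one)
  qed
  then obtain V where V: "(1 - u *\<^sub>C x) * V u = 1" "V u * (1 - u *\<^sub>C x) = 1" if "cmod u \<le> q" for u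
    by metis
  have V_diff: "norm (V u - V v) \<le> cmod (u - v) * (norm (V u) * norm x * norm (V v))"
    if "cmod u \<le> q" "cmod v \<le> q" for u v
  proof -
    have "V u - V v = V u * ((1 - v *\<^sub>C x) * V v) - (V u * (1 - u *\<^sub>C x)) * V v"
      using V that by simp
    also have "\<dots> = V u * ((u - v) *\<^sub>C x) * V v"
      by (simp add: algebra_simps scaleC_simps)
    also have "\<dots> = (u - v) *\<^sub>C (V u * x * V v)"
      by (simp add: scaleC_mult_left mult_scaleC_right)
    finally have "norm (V u - V v) = cmod (u - v) * norm (V u * x * V v)"
      by (simp add: norm_scaleC)
    also have "norm (V u * x * V v) \<le> norm (V u * x) * norm (V v)" by (rule norm_mult_ineq)
    also have "\<dots> \<le> norm (V u) * norm x * norm (V v)" by (intro mult_right_mono norm_mult_ineq) auto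
    finally show ?thesis by (simp add: mult_left_mono)
  qed
  have "continuous_on (cball 0 q) V"
    unfolding continuous_on_eq_continuous_within
  proof
    fix v :: complex assume v: "v \<in> cball 0 q"
    define a where "a = norm x * norm (V v)"
    have a: "0 \<le> a" by (simp add: a_def)
    have near: "norm (V u - V v) \<le> cmod (u - v) * (2 * norm (V v) * a)"
      if u: "cmod u \<le> q" "cmod (u - v) * a \<le> 1 / 2" for u
    proof -
      have "norm (V u - V v) \<le> norm (V u) * (cmod (u - v) * a)"
        using V_diff[of u v] u v by (simp add: a_def mult_ac)
      moreover have "\<dots> \<le> norm (V u) * (1 / 2)" using u by (intro mult_left_mono) auto
      moreover have "norm (V u) \<le> norm (V u - V v) + norm (V v)"
        using norm_triangle_ineq[of "V u - V v" "V v"] by simp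
      ultimately have "norm (V u) \<le> 2 * norm (V v)" by simp
      then have "norm (V u) * (cmod (u - v) * a) \<le> 2 * norm (V v) * (cmod (u - v) * a)"
        using a by (intro mult_right_mono) auto
      with \<open>norm (V u - V v) \<le> norm (V u) * (cmod (u - v) * a)\<close> show ?thesis by (simp add: mult_ac)
    qed
    have lim: "((\<lambda>u. cmod (u - v) * k) \<longlongrightarrow> 0) (at v within cball 0 q)" for k
      by (rule tendsto_eq_intros refl)+ simp
    have "eventually (\<lambda>u. cmod (u - v) * a < 1 / 2) (at v within cball 0 q)"
      by (rule order_tendstoD(2)[OF lim]) simp
    moreover have "eventually (\<lambda>u. u \<in> cball 0 q) (at v within cball 0 q)"
      by (simp add: eventually_at_filter)
    ultimately have "eventually (\<lambda>u. norm (V u - V v) \<le> cmod (u - v) * (2 * norm (V v) * a)) (at v within cball 0 q)"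
      by eventually_elim (auto intro: near)
    then have "((\<lambda>u. V u - V v) \<longlongrightarrow> 0) (at v within cball 0 q)"
      by (rule Lim_null_comparison[OF _ lim])
    then show "continuous (at v within cball 0 q) V"
      by (simp add: continuous_within LIM_zero_iff)
  qed
  then have "bounded (V ` cball 0 q)"
    by (intro compact_imp_bounded compact_continuous_image) auto
  then obtain B where B: "0 < B" "\<And>u. cmod u \<le> q \<Longrightarrow> norm (V u) \<le> B"
    by (auto simp: bounded_pos)
  define L where "L = B * norm x * B + 1"
  have L: "0 < L" using B(1) by (simp add: L_def add_nonneg_pos)
  have V_lip: "norm (V u - V v) \<le> L * cmod (u - v)" if "cmod u \<le> q" "cmod v \<le> q" for u v
  proof -
    have "norm (V u) * norm x * norm (V v) \<le> B * norm x * B"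
      using that B by (intro mult_mono) auto
    then have "norm (V u) * norm x * norm (V v) \<le> L" by (simp add: L_def)
    then have "cmod (u - v) * (norm (V u) * norm x * norm (V v)) \<le> cmod (u - v) * L"
      by (intro mult_left_mono) auto
    with V_diff[OF that] show ?thesis by (simp add: mult.commute)
  qed
  show ?thesis by (rule that[OF L V(1) B(2) V_lip])
qed

text \<open>
  If \<open>\<omega>\<close> is a primitive \<open>n\<close>-th root of unity, then \<open>1 - (u x)^n\<close> is inverted by the average of
  \<open>(1 - \<omega>^j u x)\<inverse>\<close> over \<open>j < n\<close>: multiplying out leaves \<open>\<Sum>k<n. (\<omega>^j u x)^k\<close>, whose average
  over \<open>j\<close> is \<open>1\<close>.  Averaging keeps the bound and the Lipschitz constant, which are therefore the same
  for all \<open>n\<close>.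
\<close>

lemma inverse_one_minus_power_equilipschitz:
  fixes x :: "'b :: complex_banach_algebra"
  assumes b: "0 < b" and q_def: "q = 1 / b"
    and inv: "\<And>z. b \<le> cmod z \<Longrightarrow> \<exists>y. (z *\<^sub>C 1 - x) * y = 1 \<and> y * (z *\<^sub>C 1 - x) = 1"
  obtains W B L where "0 < L"
    "\<And>n u. cmod u \<le> q \<Longrightarrow> 0 < n \<Longrightarrow> (1 - u ^ n *\<^sub>C x ^ n) * W n u = 1"
    "\<And>n u. cmod u \<le> q \<Longrightarrow> 0 < n \<Longrightarrow> norm (W n u) \<le> B"
    "\<And>n u v. cmod u \<le> q \<Longrightarrow> cmod v \<le> q \<Longrightarrow> 0 < n \<Longrightarrow> norm (W n u - W n v) \<le> L * cmod (u - v)"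
proof -
  obtain V B L where L: "0 < L"
    and V: "\<And>u. cmod u \<le> q \<Longrightarrow> (1 - u *\<^sub>C x) * V u = 1"
    and B: "\<And>u. cmod u \<le> q \<Longrightarrow> norm (V u) \<le> B"
    and V_lip: "\<And>u v. cmod u \<le> q \<Longrightarrow> cmod v \<le> q \<Longrightarrow> norm (V u - V v) \<le> L * cmod (u - v)"
    by (rule inverse_one_minus_scaleC_lipschitz[OF b q_def inv]) blast+
  define \<omega> where "\<omega> = (\<lambda>n. exp (2 * of_real pi * \<i> / of_nat n :: complex))"
  define W where "W = (\<lambda>n u. (\<Sum>j<n. V (\<omega> n ^ j * u)) /\<^sub>R real n)"
  have \<omega>: "cmod (\<omega> n ^ j) = 1" for n j by (simp add: \<omega>_def norm_power)
  have \<omega>q: "cmod (\<omega> n ^ j * u) \<le> q" if "cmod u \<le> q" for n j u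
    using that \<omega> by (simp add: norm_mult)
  have \<omega>n: "(\<omega> n ^ j) ^ n = 1" if "0 < n" for n j
  proof -
    have "\<omega> n ^ n = 1" unfolding \<omega>_def using complex_root_unity[of n 1] that by simp
    then show ?thesis by (metis mult.commute power_mult power_one)
  qed
  have W: "(1 - u ^ n *\<^sub>C x ^ n) * W n u = 1" if u: "cmod u \<le> q" and n: "0 < n" for u n
  proof -
    have *: "(1 - u ^ n *\<^sub>C x ^ n) * V (\<omega> n ^ j * u) = (\<Sum>k<n. ((\<omega> n ^ j) ^ k) *\<^sub>C (u ^ k *\<^sub>C x ^ k))" for j
    proof -
      define y where "y = (\<omega> n ^ j * u) *\<^sub>C x"
      have "y ^ n = u ^ n *\<^sub>C x ^ n"
        by (simp add: y_def scaleC_power power_mult_distrib \<omega>n[OF n])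
      then have "(1 - u ^ n *\<^sub>C x ^ n) * V (\<omega> n ^ j * u) = (\<Sum>k<n. y ^ k) * (1 - y) * V (\<omega> n ^ j * u)"
        by (simp add: sum_powers_times_one_minus)
      also have "\<dots> = (\<Sum>k<n. y ^ k)"
        using V[OF \<omega>q[OF u]] by (simp add: mult.assoc y_def)
      finally show ?thesis
        by (simp add: y_def scaleC_power power_mult_distrib scaleC_scaleC)
    qed
    have "(\<Sum>j<n. (1 - u ^ n *\<^sub>C x ^ n) * V (\<omega> n ^ j * u))
        = (\<Sum>k<n. \<Sum>j<n. ((\<omega> n ^ j) ^ k) *\<^sub>C (u ^ k *\<^sub>C x ^ k))"
      unfolding * by (rule sum.swap)
    also have "\<dots> = (\<Sum>k<n. (\<Sum>j<n. (\<omega> n ^ j) ^ k) *\<^sub>C (u ^ k *\<^sub>C x ^ k))"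
      by (simp add: linear_sum[OF bounded_linear.linear[OF bounded_linear_scaleC_left]])
    also have "\<dots> = (\<Sum>k<n. if k = 0 then of_nat n *\<^sub>C 1 else 0)"
      by (intro sum.cong) (auto simp: sum_unity_root_powers \<omega>_def scaleC_simps scaleC_one)
    also have "\<dots> = real n *\<^sub>R 1" using n by (simp add: scaleR_scaleC)
    finally show ?thesis using n by (simp add: W_def sum_distrib_left[symmetric])
  qed
  have W_lip: "norm (W n u - W n v) \<le> L * cmod (u - v)" if "cmod u \<le> q" "cmod v \<le> q" "0 < n" for u v n
  proof -
    have "W n u - W n v = (\<Sum>j<n. V (\<omega> n ^ j * u) - V (\<omega> n ^ j * v)) /\<^sub>R real n"
      by (simp add: W_def sum_subtractf scaleR_diff_right)
    moreover have "norm (\<Sum>j<n. V (\<omega> n ^ j * u) - V (\<omega> n ^ j * v)) \<le> (\<Sum>j<n. L * cmod (u - v))"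
    proof (rule sum_norm_le)
      fix j
      have "cmod (\<omega> n ^ j * u - \<omega> n ^ j * v) = cmod (u - v)"
        using \<omega>[of n j] by (simp add: norm_mult flip: right_diff_distrib)
      then show "norm (V (\<omega> n ^ j * u) - V (\<omega> n ^ j * v)) \<le> L * cmod (u - v)"
        using V_lip[OF \<omega>q[OF that(1)] \<omega>q[OF that(2)], of n j n j] by simp
    qed
    ultimately show ?thesis using that by (simp add: field_simps)
  qed
  have W_bdd: "norm (W n u) \<le> B" if "cmod u \<le> q" "0 < n" for u n
  proof -
    have "norm (\<Sum>j<n. V (\<omega> n ^ j * u)) \<le> (\<Sum>j<n. B)"
      by (intro sum_norm_le B \<omega>q that)
    then show ?thesis using that by (simp add: W_def field_simps)
  qed
  show ?thesis by (rule that[OF L W W_bdd W_lip])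
qed

text \<open>
  This is the hard half of the spectral radius formula, obtained from the averages above instead of
  contour integrals and functionals.  Let \<open>W n u\<close> invert \<open>1 - (u x)^n\<close>.  Where \<open>(u x)^n\<close> tends to
  zero, \<open>W n u\<close> tends to \<open>1\<close>, and conversely \<open>(u x)^n\<close> is small where \<open>W n u\<close> is close to \<open>1\<close>.
  As the \<open>W n\<close> are equicontinuous, decay at \<open>v\<close> passes on to all \<open>u\<close> within a fixed distance of
  \<open>v\<close>, and finitely many steps lead from \<open>0\<close> to \<open>q = 1 / b\<close>.
\<close>

lemma resolvent_imp_power_bound:
  fixes x :: "'b :: complex_banach_algebra"
  assumes b: "0 < b"
    and inv: "\<And>z. b \<le> cmod z \<Longrightarrow> \<exists>y. (z *\<^sub>C 1 - x) * y = 1 \<and> y * (z *\<^sub>C 1 - x) = 1"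
  obtains K where "\<And>n. norm (x ^ n) \<le> K * b ^ n"
proof -
  define q where "q = 1 / b"
  have q: "0 < q" using b by (simp add: q_def)
  obtain W B L where L: "0 < L"
    and W: "\<And>n u. cmod u \<le> q \<Longrightarrow> 0 < n \<Longrightarrow> (1 - u ^ n *\<^sub>C x ^ n) * W n u = 1"
    and W_bdd: "\<And>n u. cmod u \<le> q \<Longrightarrow> 0 < n \<Longrightarrow> norm (W n u) \<le> B"
    and W_lip: "\<And>n u v. cmod u \<le> q \<Longrightarrow> cmod v \<le> q \<Longrightarrow> 0 < n \<Longrightarrow> norm (W n u - W n v) \<le> L * cmod (u - v)"
    by (rule inverse_one_minus_power_equilipschitz[OF b q_def inv]) blast+
  define P where "P = (\<lambda>u :: real. (\<lambda>n. u ^ n * norm (x ^ n)) \<longlonglongrightarrow> 0)"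
  define \<delta> where "\<delta> = 1 / (4 * L)"
  have \<delta>: "0 < \<delta>" "L * \<delta> = 1 / 4" using L by (auto simp: \<delta>_def)
  \<comment> \<open>the step \<open>\<delta>\<close> lets \<open>W n\<close> vary by at most \<open>1/4\<close>, so that \<open>norm (W n u - 1) \<le> 1/2\<close> eventually\<close>
  have step: "eventually (\<lambda>n. u ^ n * norm (x ^ n) \<le> 1) sequentially"
    if v: "0 \<le> v" "v \<le> q" "P v" and u: "0 \<le> u" "u \<le> q" "\<bar>u - v\<bar> \<le> \<delta>" for u v
  proof -
    have "(\<lambda>n. B * (v ^ n * norm (x ^ n))) \<longlonglongrightarrow> 0"
      using v(3) unfolding P_def by (rule tendsto_mult_right_zero)
    then have "eventually (\<lambda>n. B * (v ^ n * norm (x ^ n)) < 1 / 4) sequentially"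
      by (rule order_tendstoD(2)) simp
    moreover have "eventually (\<lambda>n. 0 < n) sequentially" by (rule eventually_gt_at_top)
    ultimately show ?thesis
    proof eventually_elim
      case (elim n)
      define p where "p = (\<lambda>u :: real. complex_of_real u ^ n *\<^sub>C x ^ n)"
      have norm_p: "norm (p s) = s ^ n * norm (x ^ n)" if "0 \<le> s" for s
        using that by (simp add: p_def norm_scaleC norm_power)
      have pW: "p s * W n s = W n s - 1" if "0 \<le> s" "s \<le> q" for s
        using W[of "complex_of_real s" n] that elim(2) by (simp add: p_def algebra_simps)
      have "norm (W n v - 1) \<le> norm (p v) * norm (W n v)"
        using pW[OF v(1,2)] norm_mult_ineq by metis
      also have "\<dots> \<le> norm (p v) * B"
        using v elim by (intro mult_left_mono W_bdd) auto
      also have "\<dots> \<le> 1 / 4" using elim norm_p[OF v(1)] by (simp add: mult.commute)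
      finally have "norm (W n v - 1) \<le> 1 / 4" .
      moreover have "norm (W n u - W n v) \<le> 1 / 4"
      proof -
        have "norm (W n u - W n v) \<le> L * cmod (complex_of_real u - complex_of_real v)"
          using u v elim by (intro W_lip) auto
        also have "cmod (complex_of_real u - complex_of_real v) = \<bar>u - v\<bar>"
          by (metis norm_of_real of_real_diff real_norm_def)
        also have "L * \<bar>u - v\<bar> \<le> L * \<delta>" using L u by (intro mult_left_mono) auto
        finally show ?thesis using \<delta> by simp
      qed
      ultimately have Wu: "norm (W n u - 1) \<le> 1 / 2"
        using norm_triangle_ineq[of "W n u - W n v" "W n v - 1"] by simp
      have "p u = (W n u - 1) - p u * (W n u - 1)"
        using pW[OF u(1,2)] by (simp add: algebra_simps)
      then have "norm (p u) \<le> norm (W n u - 1) + norm (p u * (W n u - 1))"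
        by (metis norm_triangle_ineq4)
      also have "\<dots> \<le> 1 / 2 + norm (p u) * (1 / 2)"
        by (intro add_mono Wu order_trans[OF norm_mult_ineq] mult_left_mono) auto
      finally show ?case using norm_p[OF u(1)] by simp
    qed
  qed
  have decay: "P u" if "0 \<le> u" "u < u'" "eventually (\<lambda>n. u' ^ n * norm (x ^ n) \<le> 1) sequentially" for u u'
    unfolding P_def
  proof (rule tendsto_sandwich[where f = "\<lambda>_. 0" and h = "\<lambda>n. (u / u') ^ n"])
    have u': "0 < u'" using that by simp
    show "(\<lambda>n. (u / u') ^ n) \<longlonglongrightarrow> 0"
      using that by (intro LIMSEQ_realpow_zero) auto
    show "eventually (\<lambda>n. u ^ n * norm (x ^ n) \<le> (u / u') ^ n) sequentially"
      using that(3)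
    proof eventually_elim
      case (elim n)
      have "(u / u') ^ n * (u' ^ n * norm (x ^ n)) \<le> (u / u') ^ n * 1"
        using elim that by (intro mult_left_mono) auto
      then show ?case using u' by (simp add: power_divide)
    qed
  qed (use that in auto)
  have "P 0"
    unfolding P_def by (rule tendsto_eventually, rule eventually_sequentiallyI[of 1]) simp
  have steps: "\<forall>u. 0 \<le> u \<and> u < q \<and> u \<le> real k * (\<delta> / 2) \<longrightarrow> P u" for k
  proof (induction k)
    case 0
    then show ?case using \<open>P 0\<close> by auto
  next
    case (Suc k)
    show ?case
    proof (intro allI impI)
      fix u assume u: "0 \<le> u \<and> u < q \<and> u \<le> real (Suc k) * (\<delta> / 2)"
      show "P u"
      proof (cases "u \<le> real k * (\<delta> / 2)")
        case True
        then show ?thesis using Suc u by blast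
      next
        case False
        define v where "v = real k * (\<delta> / 2)"
        define u' where "u' = min q (u + \<delta> / 2)"
        have v: "0 \<le> v" "v < q" "P v" using Suc False u \<delta> by (auto simp: v_def)
        have "0 \<le> u'" "u' \<le> q" "\<bar>u' - v\<bar> \<le> \<delta>" "u < u'"
          using u v \<delta> False by (auto simp: u'_def v_def min_def algebra_simps)
        then show ?thesis using step[of v u'] v u decay[of u u'] by auto
      qed
    qed
  qed
  have P: "P u" if "0 \<le> u" "u < q" for u
  proof -
    obtain k :: nat where "u / (\<delta> / 2) \<le> real k" using real_arch_simple by blast
    then show ?thesis using steps[of k] that \<delta> by (simp add: field_simps)
  qed
  have "eventually (\<lambda>n. q ^ n * norm (x ^ n) \<le> 1) sequentially"
    using \<delta> q by (intro step[of "max 0 (q - \<delta>)"] P) (auto simp: max_def)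
  then obtain N where N: "\<And>n. N \<le> n \<Longrightarrow> q ^ n * norm (x ^ n) \<le> 1"
    by (auto simp: eventually_sequentially)
  define K where "K = 1 + (\<Sum>n<N. q ^ n * norm (x ^ n))"
  have "norm (x ^ n) \<le> K * b ^ n" for n
  proof -
    have "q ^ n * norm (x ^ n) \<le> K"
    proof (cases "n < N")
      case True
      then have "q ^ n * norm (x ^ n) \<le> (\<Sum>n<N. q ^ n * norm (x ^ n))"
        using q by (intro member_le_sum) auto
      then show ?thesis by (simp add: K_def)
    next
      case False
      then show ?thesis using N[of n] q by (simp add: K_def add_increasing2 sum_nonneg)
    qed
    then show ?thesis using b by (simp add: q_def power_divide field_simps)
  qed
  then show ?thesis by (rule that)
qed

section \<open>The algebra of bounded complex-linear operators\<close>

lemma clinear_op_zero: "clinear_op 0"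
  and clinear_op_id: "clinear_op id_blinfun"
  and clinear_op_add: "clinear_op S \<Longrightarrow> clinear_op T \<Longrightarrow> clinear_op (S + T)"
  and clinear_op_diff: "clinear_op S \<Longrightarrow> clinear_op T \<Longrightarrow> clinear_op (S - T)"
  and clinear_op_minus: "clinear_op S \<Longrightarrow> clinear_op (- S)"
  and clinear_op_scaleC: "clinear_op S \<Longrightarrow> clinear_op (a *\<^sub>C S)"
  and clinear_op_scaleR: "clinear_op S \<Longrightarrow> clinear_op (r *\<^sub>R S)"
  by (simp_all add: clinear_op_def scaleC_simps scaleC_add_right blinfun.bilinear_simps
      scaleC_blinfun.rep_eq scaleC_scaleC scaleR_scaleC mult.commute
      linear_neg[OF bounded_linear.linear[OF bounded_linear_scaleC]])

lemma clinear_op_compose: "clinear_op S \<Longrightarrow> clinear_op T \<Longrightarrow> clinear_op (S o\<^sub>L T)"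
  by (simp add: clinear_op_def)

lemma closed_clinear_op: "closed {T. clinear_op T}"
proof -
  have "{T. clinear_op T} = (\<Inter>c x. {T. blinfun_apply T (c *\<^sub>C x) = c *\<^sub>C blinfun_apply T x})"
    by (auto simp: clinear_op_def)
  also have "closed \<dots>"
    by (intro closed_INT ballI closed_Collect_eq continuous_intros
        bounded_linear.continuous_on[OF bounded_linear_scaleC])
  finally show ?thesis .
qed

text \<open>
  The complex-linear operators as a type of their own, because the operators between two different
  spaces have no product and the real-linear ones do not commute with complex scalars.
\<close>

typedef (overloaded) 'a cendo = "{T :: 'a :: cbanach \<Rightarrow>\<^sub>L 'a. clinear_op T}"
  morphisms op_of cendo_of
  using clinear_op_zero by auto

setup_lifting type_definition_cendo

lemma clinear_op_of: "clinear_op (op_of x)"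
  using op_of by simp

instantiation cendo :: (cbanach) "{complex_normed_vector, real_normed_algebra, monoid_mult}"
begin

lift_definition zero_cendo :: "'a cendo" is 0 by (rule clinear_op_zero)
lift_definition one_cendo :: "'a cendo" is id_blinfun by (rule clinear_op_id)
lift_definition plus_cendo :: "'a cendo \<Rightarrow> 'a cendo \<Rightarrow> 'a cendo" is "(+)" by (rule clinear_op_add)
lift_definition minus_cendo :: "'a cendo \<Rightarrow> 'a cendo \<Rightarrow> 'a cendo" is "(-)" by (rule clinear_op_diff)
lift_definition uminus_cendo :: "'a cendo \<Rightarrow> 'a cendo" is uminus by (rule clinear_op_minus)
lift_definition times_cendo :: "'a cendo \<Rightarrow> 'a cendo \<Rightarrow> 'a cendo" is "(o\<^sub>L)" by (rule clinear_op_compose)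
lift_definition scaleR_cendo :: "real \<Rightarrow> 'a cendo \<Rightarrow> 'a cendo" is "(*\<^sub>R)" by (rule clinear_op_scaleR)
lift_definition scaleC_cendo :: "complex \<Rightarrow> 'a cendo \<Rightarrow> 'a cendo" is "(*\<^sub>C)" by (rule clinear_op_scaleC)
lift_definition norm_cendo :: "'a cendo \<Rightarrow> real" is norm .

definition dist_cendo :: "'a cendo \<Rightarrow> 'a cendo \<Rightarrow> real" where
  "dist_cendo x y = norm (x - y)"
definition sgn_cendo :: "'a cendo \<Rightarrow> 'a cendo" where
  "sgn_cendo x = inverse (norm x) *\<^sub>R x"
definition uniformity_cendo :: "('a cendo \<times> 'a cendo) filter" where
  "uniformity_cendo = (INF e\<in>{0<..}. principal {(x, y). dist x y < e})"
definition open_cendo :: "'a cendo set \<Rightarrow> bool" where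
  "open_cendo S = (\<forall>x\<in>S. \<forall>\<^sub>F (x', y) in uniformity. x' = x \<longrightarrow> y \<in> S)"

instance
proof
  fix x y z :: "'a cendo" and a b :: complex and r s :: real
  show "x + y + z = x + (y + z)" "x + y = y + x" "0 + x = x" "- x + x = 0" "x - y = x + - y"
    by (transfer; simp add: algebra_simps)+
  show "r *\<^sub>R (x + y) = r *\<^sub>R x + r *\<^sub>R y" "(r + s) *\<^sub>R x = r *\<^sub>R x + s *\<^sub>R x"
    "r *\<^sub>R s *\<^sub>R x = (r * s) *\<^sub>R x" "1 *\<^sub>R x = x"
    by (transfer; simp add: algebra_simps)+
  show "a *\<^sub>C (x + y) = a *\<^sub>C x + a *\<^sub>C y" "(a + b) *\<^sub>C x = a *\<^sub>C x + b *\<^sub>C x"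
    "a *\<^sub>C b *\<^sub>C x = (a * b) *\<^sub>C x" "1 *\<^sub>C x = x" "r *\<^sub>R x = complex_of_real r *\<^sub>C x"
    by (transfer; simp add: scaleC_add_right scaleC_add_left scaleC_scaleC scaleC_one scaleR_scaleC)+
  show "x * y * z = x * (y * z)" "1 * x = x" "x * 1 = x"
    by (transfer; rule blinfun_eqI; simp)+
  show "(x + y) * z = x * z + y * z" "x * (y + z) = x * y + x * z"
    "r *\<^sub>R x * y = r *\<^sub>R (x * y)" "x * r *\<^sub>R y = r *\<^sub>R (x * y)"
    by (transfer; rule blinfun_eqI; simp add: blinfun.bilinear_simps)+
  show "norm (x * y) \<le> norm x * norm y" by transfer (rule norm_blinfun_compose)
  show "norm x = 0 \<longleftrightarrow> x = 0" by transfer simp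
  show "norm (x + y) \<le> norm x + norm y" by transfer (rule norm_triangle_ineq)
  show "norm (r *\<^sub>R x) = \<bar>r\<bar> * norm x" by transfer simp
  show "norm (a *\<^sub>C x) = cmod a * norm x" by transfer (rule norm_scaleC)
qed (simp_all add: dist_cendo_def sgn_cendo_def uniformity_cendo_def open_cendo_def)

end

instance cendo :: (cbanach) complex_banach_algebra
proof
  fix x y :: "'a cendo" and a :: complex
  show "a *\<^sub>C x * y = a *\<^sub>C (x * y)" "x * a *\<^sub>C y = a *\<^sub>C (x * y)"
    by (transfer; rule blinfun_eqI; simp add: scaleC_blinfun.rep_eq clinear_op_def)+
  show "norm (1 :: 'a cendo) \<le> 1" by transfer (rule norm_blinfun_id_le)
next
  fix X :: "nat \<Rightarrow> 'a cendo"
  have dist: "dist (op_of x) (op_of y) = dist x y" for x y :: "'a cendo"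
    by (simp add: dist_norm dist_cendo_def norm_cendo.rep_eq minus_cendo.rep_eq)
  assume "Cauchy X"
  then have "Cauchy (\<lambda>n. op_of (X n))" by (simp add: Cauchy_def dist)
  then obtain T where T: "(\<lambda>n. op_of (X n)) \<longlonglongrightarrow> T"
    using Cauchy_convergent convergent_def by blast
  have "T \<in> {T. clinear_op T}"
    by (rule closed_sequentially[OF closed_clinear_op _ T]) (simp add: clinear_op_of)
  then obtain L where "T = op_of L" by (metis cendo_of_inverse)
  then have "X \<longlonglongrightarrow> L"
    using T by (simp add: tendsto_iff dist)
  then show "convergent X" by (auto simp: convergent_def)
qed

lemma norm_op_of: "norm (op_of x) = norm x"
  by (simp add: norm_cendo.rep_eq)

lemma bounded_linear_op_of: "bounded_linear op_of"
  by (rule bounded_linear_intro[where K = 1])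
    (simp_all add: plus_cendo.rep_eq scaleR_cendo.rep_eq norm_op_of)

lemma op_of_power: "op_of (x ^ n) = op_pow (op_of x) n"
  by (induction n) (simp_all add: op_pow_def one_cendo.rep_eq times_cendo.rep_eq)

lemma op_of_fps_at:
  "fps_abs_conv F x \<Longrightarrow> (\<lambda>n. fps_nth F n *\<^sub>R op_pow (op_of x) n) sums op_of (fps_at F x)"
  using bounded_linear.sums[OF bounded_linear_op_of fps_at_sums]
  by (simp add: scaleR_cendo.rep_eq op_of_power)

lemma op_pow_scaleC:
  fixes T :: "'a :: cbanach \<Rightarrow>\<^sub>L 'a"
  shows "clinear_op T \<Longrightarrow> op_pow (a *\<^sub>C T) n = a ^ n *\<^sub>C op_pow T n"
  using op_of_power[of "a *\<^sub>C cendo_of T" n] op_of_power[of "cendo_of T" n]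
  by (simp add: scaleC_power scaleC_cendo.rep_eq cendo_of_inverse)

lemma op_exp_scaleC_sums:
  fixes T :: "'a :: cbanach \<Rightarrow>\<^sub>L 'a"
  assumes "clinear_op T"
  shows "(\<lambda>n. (a ^ n / fact n) *\<^sub>C op_pow T n) sums op_exp (a *\<^sub>C T)"
proof -
  have "(\<lambda>n. op_pow (a *\<^sub>C T) n /\<^sub>R fact n) sums op_exp (a *\<^sub>C T)"
    unfolding op_exp_def by (intro summable_sums summable_norm_cancel[OF summable_op_exp])
  moreover have "op_pow (a *\<^sub>C T) n /\<^sub>R fact n = (a ^ n / fact n) *\<^sub>C op_pow T n" for n
    using assms by (simp add: op_pow_scaleC scaleR_scaleC scaleC_scaleC divide_inverse mult.commute)
  ultimately show ?thesis by simp
qed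

lemma op_exp_scaleR:
  "op_exp (a *\<^sub>R op_of x) = op_of (fps_at (fps_exp a) x)"
proof -
  have "(\<lambda>n. (complex_of_real a ^ n / fact n) *\<^sub>C op_pow (op_of x) n) sums op_exp (a *\<^sub>R op_of x)"
    unfolding scaleR_scaleC by (rule op_exp_scaleC_sums[OF clinear_op_of])
  moreover have "(\<lambda>n. (complex_of_real a ^ n / fact n) *\<^sub>C op_pow (op_of x) n) sums op_of (fps_at (fps_exp a) x)"
    using op_of_fps_at[OF fps_abs_conv_entire[OF fps_conv_radius_exp[of a]], of x]
    by (simp add: scaleR_scaleC)
  ultimately show ?thesis by (rule sums_unique2)
qed

text \<open>
  The inverse is \<open>(1 / z) \<Sum>n. (x / z)^n\<close>.
\<close>

lemma ex_inverse_if_norm_less: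
  fixes x :: "'b :: complex_banach_algebra"
  assumes "norm x < cmod z"
  shows "\<exists>y. (z *\<^sub>C 1 - x) * y = 1 \<and> y * (z *\<^sub>C 1 - x) = 1"
proof -
  define u where "u = (1 / z) *\<^sub>C x"
  have z: "0 < cmod z" using assms norm_ge_zero[of x] by linarith
  have u: "norm u < 1" using assms z by (simp add: u_def norm_scaleC norm_divide)
  define G :: "real fps" where "G = Abs_fps (\<lambda>_. 1)"
  have G: "fps_abs_conv G u"
    unfolding fps_abs_conv_def
    by (rule summable_comparison_test'[OF summable_geometric[of "norm u"]])
      (use u in \<open>auto simp: G_def norm_power_le\<close>)
  define g where "g = fps_at G u"
  have g: "g = 1 + fps_at G u * u"
  proof -
    have "(\<lambda>n. u ^ n) sums g" using fps_at_sums[OF G] by (simp add: g_def G_def)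
    then have "(\<lambda>n. u ^ n * u) sums (g * u)" by (rule bounded_linear.sums[OF bounded_linear_mult_left])
    then have "(\<lambda>n. u ^ Suc n) sums (g * u)" by (simp add: power_commutes)
    from sums_Suc[OF this] have "(\<lambda>n. u ^ n) sums (g * u + 1)" by simp
    with \<open>(\<lambda>n. u ^ n) sums g\<close> have "g = g * u + 1" by (rule sums_unique2)
    then show ?thesis by (simp add: g_def add.commute)
  qed
  have "g * (1 - u) = 1" using g by (simp add: g_def algebra_simps)
  moreover have "fps_at G u * u = u * fps_at G u" by (rule fps_at_commute[OF G]) simp
  then have "(1 - u) * g = 1" using g by (simp add: g_def algebra_simps)
  moreover have "z *\<^sub>C 1 - x = z *\<^sub>C (1 - u)"
    using z by (auto simp: u_def scaleC_simps scaleC_scaleC scaleC_one)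
  ultimately show ?thesis
    using z by (intro exI[of _ "(1 / z) *\<^sub>C g"])
      (auto simp: scaleC_mult_left mult_scaleC_right scaleC_scaleC scaleC_one)
qed

lemma op_invertible_op_of: "op_invertible (op_of w) \<longleftrightarrow> (\<exists>y. w * y = 1 \<and> y * w = 1)"
proof
  assume "op_invertible (op_of w)"
  then obtain S where S: "clinear_op S" "S o\<^sub>L op_of w = id_blinfun" "op_of w o\<^sub>L S = id_blinfun"
    by (auto simp: op_invertible_def)
  then obtain y where "S = op_of y" by (metis cendo_of_inverse mem_Collect_eq)
  with S have "w * y = 1 \<and> y * w = 1"
    by (metis op_of_inject one_cendo.rep_eq times_cendo.rep_eq)
  then show "\<exists>y. w * y = 1 \<and> y * w = 1" by blast
next
  assume "\<exists>y. w * y = 1 \<and> y * w = 1"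
  then obtain y where "w * y = 1" "y * w = 1" by blast
  then have "op_of w o\<^sub>L op_of y = id_blinfun" "op_of y o\<^sub>L op_of w = id_blinfun"
    by (metis one_cendo.rep_eq times_cendo.rep_eq)+
  then show "op_invertible (op_of w)" using clinear_op_of by (auto simp: op_invertible_def)
qed

lemma spectrum_op_of:
  "z \<in> spectrum (op_of x) \<longleftrightarrow> \<not> (\<exists>y. (z *\<^sub>C 1 - x) * y = 1 \<and> y * (z *\<^sub>C 1 - x) = 1)"
  unfolding spectrum_def
  by (simp add: op_invertible_op_of[symmetric] minus_cendo.rep_eq scaleC_cendo.rep_eq one_cendo.rep_eq)

lemma cmod_le_norm_if_spectrum: "z \<in> spectrum (op_of x) \<Longrightarrow> cmod z \<le> norm x"
  using ex_inverse_if_norm_less[of x z] by (auto simp: spectrum_op_of not_le[symmetric])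

lemma spectral_radius_le_norm: "spectral_radius (op_of x) \<le> norm x"
  unfolding spectral_radius_def by (intro cSup_least) (auto dest: cmod_le_norm_if_spectrum)

lemma bdd_above_spectrum: "bdd_above (insert 0 (cmod ` spectrum (op_of x)))"
  by (intro bdd_aboveI[of _ "norm x"]) (auto dest: cmod_le_norm_if_spectrum)

lemma spectral_radius_nonneg: "0 \<le> spectral_radius (op_of x)"
  unfolding spectral_radius_def by (intro cSup_upper bdd_above_spectrum) simp

lemma power_bound_above_spectral_radius:
  assumes "spectral_radius (op_of x) < b"
  obtains K where "\<And>n. norm (x ^ n) \<le> K * b ^ n"
proof -
  have b: "0 < b" using assms spectral_radius_nonneg[of x] by linarith
  have ex: "\<exists>y. (z *\<^sub>C 1 - x) * y = 1 \<and> y * (z *\<^sub>C 1 - x) = 1" if "b \<le> cmod z" for z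
  proof -
    have "z \<notin> spectrum (op_of x)"
    proof
      assume "z \<in> spectrum (op_of x)"
      then have "cmod z \<le> spectral_radius (op_of x)"
        unfolding spectral_radius_def by (intro cSup_upper bdd_above_spectrum) simp
      with assms that show False by simp
    qed
    then show ?thesis by (simp add: spectrum_op_of)
  qed
  show ?thesis by (rule resolvent_imp_power_bound[OF b ex that])
qed

text \<open>
  For \<open>b\<close> above the spectral radius \<open>r\<close>, the powers of \<open>x\<close> grow at most like \<open>b^n\<close>, so that \<open>h\<close>
  converges at \<open>t x\<close> for \<open>t < t0 / b\<close>.  Letting \<open>t\<close> tend to \<open>t0 / b\<close> and then \<open>b\<close> to \<open>r\<close> gives
  \<open>t0 norm x \<le> r g\<close>, where \<open>g\<close> is the sum of the inverse series at \<open>m\<close>; recall that \<open>g \<le> t0\<close>, strictly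
  if \<open>m < F t0\<close>, and that \<open>r \<le> norm x\<close>.
\<close>

lemma (in entire_with_positive_inverse) norm_eq_spectral_radius_if_bounded:
  fixes x :: "'a :: cbanach cendo"
  assumes m: "m \<le> eval_fps F t0" "\<And>t. 0 < t \<Longrightarrow> norm (fps_at F (t *\<^sub>R x)) \<le> m"
  shows "spectral_radius (op_of x) = norm x" "m < eval_fps F t0 \<Longrightarrow> x = 0"
proof -
  define r where "r = spectral_radius (op_of x)"
  define g where "g = fps_at c m"
  have m0: "0 \<le> m" by (rule order_trans[OF norm_ge_zero m(2)[of 1]]) simp
  note g = compositional_inverse_conv(2,3)[OF m0 m(1), folded g_def]
  have r: "0 \<le> r" "r \<le> norm x"
    by (simp_all add: r_def spectral_radius_nonneg spectral_radius_le_norm)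
  have *: "t0 * norm x \<le> b * g" if rb: "r < b" for b
  proof -
    have b: "0 < b" using rb r by simp
    obtain K where K: "\<And>n. norm (x ^ n) \<le> K * b ^ n"
      by (rule power_bound_above_spectral_radius[OF rb[unfolded r_def]]) blast
    have conv: "fps_abs_conv h (t *\<^sub>R x)" if t: "0 \<le> t" "t < t0 / b" for t
    proof (rule fps_abs_conv_bounded_powers[where K = K and b = "t * b"])
      show "norm ((t *\<^sub>R x) ^ n) \<le> K * (t * b) ^ n" for n
        using mult_left_mono[OF K[of n], of "t ^ n"] t
        by (simp add: power_scaleR power_mult_distrib mult_ac)
      show "0 \<le> t * b" using t b by simp
      have "t * b < t0" using t b by (simp add: field_simps)
      then show "ereal (t * b) < fps_conv_radius h" using h_conv
        by (intro less_le_trans[OF _ h_conv]) simp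
    qed
    have tx: "t * norm x \<le> g" if "0 < t" "t < t0 / b" for t
      unfolding g_def
      by (rule norm_le_compositional_inverse[OF m conv that])
    have "t0 / b * norm x \<le> g"
    proof (rule field_le_mult_one_interval)
      fix \<theta> :: real assume \<theta>: "0 < \<theta>" "\<theta> < 1"
      have "\<theta> * (t0 / b) < 1 * (t0 / b)" using \<theta> t0 b by (intro mult_strict_right_mono) auto
      then show "\<theta> * (t0 / b * norm x) \<le> g" using tx[of "\<theta> * (t0 / b)"] \<theta> t0 b by simp
    qed
    then show ?thesis using b by (simp add: field_simps)
  qed
  have "((\<lambda>b. b * g) \<longlongrightarrow> r * g) (at_right r)" by (intro tendsto_intros)
  then have **: "t0 * norm x \<le> r * g"
    by (rule tendsto_lowerbound) (auto simp: eventually_at_right_less intro: eventually_mono[OF eventually_at_right_less] *)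
  have "r * g \<le> r * t0" using g r by (intro mult_left_mono) auto
  with ** have "t0 * norm x \<le> t0 * r" by (simp add: mult.commute)
  then have "norm x \<le> r" using t0 by simp
  with r show "spectral_radius (op_of x) = norm x" by (simp add: r_def)
  assume "m < eval_fps F t0"
  then have "g < t0" by (rule g(2))
  show "x = 0"
  proof (rule ccontr)
    assume "x \<noteq> 0"
    then have "0 < r" using \<open>norm x \<le> r\<close> by (metis norm_le_zero_iff not_le order_trans)
    then have "r * g < r * t0" using \<open>g < t0\<close> by simp
    with ** \<open>r \<le> norm x\<close> have "t0 * norm x < t0 * norm x"
      using t0 by (smt (verit) mult.commute mult_left_mono)
    then show False by simp
  qed
qed

text \<open>
  The constant \<open>\<kappa>\<close> absorbs a scalar factor of \<open>F\<close>, since \<open>F\<close> itself must have real coefficients.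
\<close>

lemma (in entire_with_positive_inverse) supremum_criterion:
  fixes A :: "'a :: cbanach \<Rightarrow>\<^sub>L 'a"
  assumes A: "clinear_op A"
    and \<kappa>: "0 < \<kappa>" "bound = \<kappa> * eval_fps F t0"
    and \<phi>: "\<And>t. 0 < t \<Longrightarrow> \<phi> t = \<kappa> * norm (fps_at F (t *\<^sub>R cendo_of A))"
  shows "((SUP t\<in>{0<..}. ereal (\<phi> t)) \<le> ereal bound \<longrightarrow> spectral_radius A = norm A)
       \<and> ((SUP t\<in>{0<..}. ereal (\<phi> t)) < ereal bound \<longrightarrow> A = 0)"
proof -
  define x where "x = cendo_of A"
  have x: "op_of x = A" using A by (simp add: x_def cendo_of_inverse)
  note est = norm_eq_spectral_radius_if_bounded[where x = x]
  have bound: "norm (fps_at F (t *\<^sub>R x)) \<le> m / \<kappa>"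
    if "(SUP t\<in>{0<..}. ereal (\<phi> t)) \<le> ereal m" "0 < t" for m t
  proof -
    have "ereal (\<phi> t) \<le> ereal m"
      using that by (intro order_trans[OF SUP_upper that(1)]) auto
    then show ?thesis using \<phi>[OF that(2)] \<kappa>(1) by (simp add: x_def field_simps)
  qed
  have "spectral_radius A = norm A" if "(SUP t\<in>{0<..}. ereal (\<phi> t)) \<le> ereal bound"
    using est(1)[OF _ bound[OF that]] \<kappa> by (simp add: x flip: norm_op_of)
  moreover have "A = 0" if less: "(SUP t\<in>{0<..}. ereal (\<phi> t)) < ereal bound"
  proof -
    obtain m where m: "(SUP t\<in>{0<..}. ereal (\<phi> t)) < ereal m" "ereal m < ereal bound"
      using ereal_dense2[OF less] by blast
    then have "x = 0"
      using est(2)[OF _ bound[OF less_imp_le[OF m(1)]]] \<kappa> by (simp add: field_simps)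
    then show ?thesis using x by (simp add: zero_cendo.rep_eq)
  qed
  ultimately show ?thesis by blast
qed

section \<open>The three families of functions\<close>

lemma fps_conv_radius_geI:
  fixes F :: "real fps"
  assumes "\<And>x. 0 < x \<Longrightarrow> ereal x < R \<Longrightarrow> fps_abs_conv F (x :: real)"
  shows "R \<le> fps_conv_radius F"
  unfolding fps_conv_radius_def
proof (rule conv_radius_geI_ex)
  fix r :: real assume r: "0 < r" "ereal r < R"
  have "summable (\<lambda>n. fps_nth F n * r ^ n)"
    using fps_abs_conv_summable(2)[OF assms[OF r]] by simp
  then show "\<exists>z. norm z = r \<and> summable (\<lambda>n. fps_nth F n * z ^ n)"
    using r by (intro exI[of _ r]) auto
qed

text \<open>
  The reciprocal \<open>y\<close> satisfies \<open>y = 1 + u y\<close>.  Comparing coefficients gives a recursion with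
  nonnegative terms, and comparing partial sums at \<open>x\<close> gives \<open>Y \<le> 1 + u x Y\<close>, hence the bound
  \<open>1 / (1 - u x)\<close>.
\<close>

lemma inverse_one_minus:
  fixes u :: "real fps"
  assumes R: "0 < R" and u: "\<And>n. 0 \<le> fps_nth u n"
    and conv: "ereal R \<le> fps_conv_radius u"
    and less: "\<And>x. 0 \<le> x \<Longrightarrow> x < R \<Longrightarrow> eval_fps u x < 1"
  shows "0 \<le> fps_nth (inverse (1 - u)) n"
    and "ereal R \<le> fps_conv_radius (inverse (1 - u))"
    and "inverse (1 - u) * (1 - u) = 1"
proof -
  define y where "y = inverse (1 - u)"
  have u0: "fps_nth u 0 < 1" using less[of 0] R by (simp add: eval_fps_at_0)
  show y1: "inverse (1 - u) * (1 - u) = 1" using u0 by (intro inverse_mult_eq_1) simp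
  then have y: "y = 1 + u * y" by (simp add: y_def algebra_simps)
  have rec: "fps_nth y n * (1 - fps_nth u 0) = fps_nth 1 n + (\<Sum>i=1..n. fps_nth u i * fps_nth y (n - i))" for n
  proof -
    have "fps_nth y n = fps_nth 1 n + (\<Sum>i=0..n. fps_nth u i * fps_nth y (n - i))"
      by (subst y) (simp add: fps_mult_nth)
    also have "(\<Sum>i=0..n. fps_nth u i * fps_nth y (n - i))
        = fps_nth u 0 * fps_nth y n + (\<Sum>i=1..n. fps_nth u i * fps_nth y (n - i))"
      by (simp add: sum.atLeast_Suc_atMost)
    finally show ?thesis by (simp add: algebra_simps)
  qed
  have nonneg: "0 \<le> fps_nth y n" for n
  proof (induction n rule: less_induct)
    case (less n)
    have "0 \<le> fps_nth y n * (1 - fps_nth u 0)"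
      unfolding rec using less u by (intro add_nonneg_nonneg sum_nonneg mult_nonneg_nonneg) auto
    then show ?case using u0 by (simp add: zero_le_mult_iff)
  qed
  then show "0 \<le> fps_nth (inverse (1 - u)) n" by (simp add: y_def)
  show "ereal R \<le> fps_conv_radius (inverse (1 - u))"
  proof (rule fps_conv_radius_geI)
    fix x :: real assume x: "0 < x" "ereal x < ereal R"
    define v where "v = eval_fps u x"
    have uconv: "fps_abs_conv u x"
      using x conv by (intro fps_abs_conv_bounded_powers[where K = 1 and b = x] less_le_trans[OF _ conv]) auto
    have v: "v < 1" using less[of x] x by (simp add: v_def)
    have bound: "(\<Sum>n<N. fps_nth y n * x ^ n) \<le> 1 / (1 - v)" for N
    proof -
      define Y where "Y = (\<Sum>n<N. fps_nth y n * x ^ n)"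
      have Y0: "0 \<le> Y" unfolding Y_def using nonneg x by (intro sum_nonneg) auto
      have "Y = (\<Sum>n<N. fps_nth 1 n * x ^ n) + (\<Sum>n<N. \<Sum>i\<le>n. (fps_nth u i * x ^ i) * (fps_nth y (n - i) * x ^ (n - i)))"
        unfolding Y_def
        by (subst y, simp add: fps_mult_nth sum_distrib_right distrib_right sum.distrib atLeast0AtMost)
          (auto intro!: sum.cong simp: mult_ac simp flip: power_add)
      also have "(\<Sum>n<N. fps_nth 1 n * x ^ n) \<le> (1 :: real)"
      proof -
        have "fps_nth 1 n * x ^ n = (if n = 0 then 1 else 0)" for n by (cases n) auto
        then have "(\<Sum>n<N. fps_nth 1 n * x ^ n) = (\<Sum>n<N. if n = 0 then 1 else 0)"
          by (intro sum.cong) auto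
        then show ?thesis by simp
      qed
      also have "(\<Sum>n<N. \<Sum>i\<le>n. (fps_nth u i * x ^ i) * (fps_nth y (n - i) * x ^ (n - i)))
          = (\<Sum>(i, j)\<in>{(i, j). i + j < N}. (fps_nth u i * x ^ i) * (fps_nth y j * x ^ j))"
        by (rule sum.triangle_reindex[symmetric])
      also have "\<dots> \<le> (\<Sum>(i, j)\<in>{..<N} \<times> {..<N}. (fps_nth u i * x ^ i) * (fps_nth y j * x ^ j))"
        using x u nonneg by (intro sum_mono2) auto
      also have "\<dots> = (\<Sum>i<N. fps_nth u i * x ^ i) * Y"
        by (simp add: Y_def sum_product sum.cartesian_product)
      also have "\<dots> \<le> v * Y"
        using fps_at_nonneg[OF uconv u, of N] x Y0
        by (intro mult_right_mono) (auto simp: v_def fps_at_real)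
      finally have "Y * (1 - v) \<le> 1" by (simp add: algebra_simps)
      then show ?thesis using v by (simp add: Y_def field_simps)
    qed
    have "summable (\<lambda>n. fps_nth y n * x ^ n)"
      using bound nonneg x by (intro summableI_nonneg_bounded[where x = "1 / (1 - v)"]) auto
    then show "fps_abs_conv (inverse (1 - u)) x"
      using nonneg x by (simp add: fps_abs_conv_def y_def)
  qed
qed

lemma fps_mult_nonneg:
  fixes F G :: "real fps"
  assumes "\<And>n. 0 \<le> fps_nth F n" "\<And>n. 0 \<le> fps_nth G n"
  shows "0 \<le> fps_nth (F * G) n"
  using assms by (auto simp: fps_mult_nth intro!: sum_nonneg)

lemma conv_radius_mult_geI:
  fixes F G :: "real fps"
  shows "R \<le> fps_conv_radius F \<Longrightarrow> R \<le> fps_conv_radius G \<Longrightarrow> R \<le> fps_conv_radius (F * G)"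
  using fps_conv_radius_mult[of F G] by (meson min.boundedI order_trans)

lemma fps_exp_mult_minus: "fps_exp a * fps_exp (- a) = (1 :: real fps)"
  by (simp flip: fps_exp_add_mult)

text \<open>
  Here \<open>F' = s exp (- s z) (1 - u)\<close> with \<open>u = exp ((s - 1) z) / s\<close>, and \<open>t0\<close> is where \<open>u = 1\<close>.
\<close>

lemma exp_difference_positive_inverse:
  fixes s :: real
  assumes s: "1 < s"
  defines "F \<equiv> fps_exp (- 1) - fps_exp (- s)"
    and "h \<equiv> fps_const (1 / s) * fps_exp s * inverse (1 - fps_const (1 / s) * fps_exp (s - 1))"
    and "t0 \<equiv> ln s / (s - 1)"
  shows "entire_with_positive_inverse F h t0"
    and "eval_fps F t0 = (s - 1) * s powr (- s / (s - 1))"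
proof -
  define u where "u = fps_const (1 / s) * fps_exp (s - 1)"
  have F: "fps_conv_radius F = \<infinity>"
    unfolding F_def using fps_conv_radius_diff[of "fps_exp (- 1) :: real fps" "fps_exp (- s)"] by simp
  have F01: "fps_nth F 0 = 0" "0 < fps_nth F 1" using s by (simp_all add: F_def)
  have t0: "0 < t0" using s by (simp add: t0_def)
  have u_radius: "fps_conv_radius u = \<infinity>"
    using s by (simp add: u_def fps_conv_radius_cmult_left)
  have u_eval: "eval_fps u x = exp ((s - 1) * x) / s" for x
    by (simp add: u_def eval_fps_mult)
  have u_nonneg: "0 \<le> fps_nth u n" for n using s by (simp add: u_def)
  have u_less: "eval_fps u x < 1" if "0 \<le> x" "x < t0" for x
  proof -
    have "(s - 1) * x < ln s" using that s by (simp add: t0_def field_simps)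
    then have "exp ((s - 1) * x) < s" using s by (metis exp_less_mono exp_ln less_trans zero_less_one)
    then show ?thesis using s by (simp add: u_eval)
  qed
  note inv = inverse_one_minus[OF t0 u_nonneg _ u_less, unfolded u_radius, simplified]
  have "fps_deriv F = fps_const s * fps_exp (- s) - fps_exp (- 1)"
    by (simp add: F_def fps_exp_deriv flip: fps_const_neg)
  also have "fps_exp (- 1 :: real) = fps_exp (- s) * fps_exp (s - 1)"
    by (simp flip: fps_exp_add_mult)
  also have "fps_const s * fps_exp (- s) - fps_exp (- s) * fps_exp (s - 1) = fps_const s * fps_exp (- s) * (1 - u)"
    using s by (simp add: u_def algebra_simps fps_const_mult[symmetric] del: fps_const_mult)
  finally have F': "fps_deriv F = fps_const s * fps_exp (- s) * (1 - u)" .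
  have "h * fps_deriv F = (fps_const (1 / s) * fps_const s) * (fps_exp s * fps_exp (- s)) * (inverse (1 - u) * (1 - u))"
    unfolding F' h_def u_def[symmetric] by (simp only: mult_ac)
  also have "\<dots> = 1" using inv(3) s by (simp add: fps_exp_mult_minus)
  finally have h_inv: "h * fps_deriv F = 1" .
  have h_nonneg: "0 \<le> fps_nth h n" for n
    unfolding h_def u_def[symmetric] using s inv(1) by (intro fps_mult_nonneg) auto
  have h_conv: "ereal t0 \<le> fps_conv_radius h"
    unfolding h_def u_def[symmetric] using s inv(2)
    by (intro conv_radius_mult_geI) (auto simp: fps_conv_radius_cmult_left)
  show "entire_with_positive_inverse F h t0"
    by (unfold_locales; fact F F01 t0 h_inv h_nonneg h_conv)
  have "eval_fps F t0 = exp (- t0) - exp (- s * t0)"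
    by (simp add: F_def eval_fps_diff)
  also have "exp (- t0) = s * exp (- s * t0)"
  proof -
    have "exp (- t0) = exp ((s - 1) * t0) * exp (- s * t0)"
      by (simp add: exp_add[symmetric] algebra_simps)
    also have "(s - 1) * t0 = ln s" using s by (simp add: t0_def)
    finally show ?thesis using s by simp
  qed
  also have "exp (- s * t0) = s powr (- s / (s - 1))"
    using s by (simp add: powr_def t0_def)
  finally show "eval_fps F t0 = (s - 1) * s powr (- s / (s - 1))" by (simp add: algebra_simps)
qed


text \<open>
  Here \<open>F' = exp (- z^m) (1 - u)\<close> with \<open>u = m z^m\<close>, and \<open>t0\<close> is where \<open>u = 1\<close>.
\<close>

lemma exp_monomial_positive_inverse:
  fixes m :: nat
  assumes m: "0 < m"
  defines "F \<equiv> fps_X * (fps_exp (- 1 :: real) oo fps_X ^ m)"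
    and "h \<equiv> (fps_exp (1 :: real) oo fps_X ^ m) * inverse (1 - fps_const (real m) * fps_X ^ m)"
    and "t0 \<equiv> (1 / real m) powr (1 / real m)"
  shows "entire_with_positive_inverse F h t0"
    and "eval_fps F t0 = (real m * exp 1) powr (- 1 / real m)"
    and "fps_at F y = y * fps_at (fps_exp (- 1)) (y ^ m)"
proof -
  define u :: "real fps" where "u = fps_const (real m) * fps_X ^ m"
  have X0: "fps_nth (fps_X ^ m :: real fps) 0 = 0" using m by simp
  have X_nonneg: "0 \<le> fps_nth (fps_X ^ m :: real fps) k" for k by (simp add: fps_X_power_nth)
  have X_conv: "fps_abs_conv (fps_X ^ m) z" for z :: "'c :: unital_banach_algebra"
    by (rule fps_abs_conv_entire) simp
  have E_radius: "fps_conv_radius (fps_exp a oo fps_X ^ m) = \<infinity>" for a :: real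
  proof -
    have "\<infinity> \<le> fps_conv_radius (fps_exp a oo fps_X ^ m)"
      by (rule fps_conv_radius_geI, rule fps_abs_conv_compose[OF fps_conv_radius_exp X0 X_nonneg X_conv, where x = "0 :: real"])
        simp
    then show ?thesis by simp
  qed
  have E_at: "fps_at (fps_exp a oo fps_X ^ m) z = fps_at (fps_exp a) (z ^ m)"
    for a and z :: "'c :: unital_banach_algebra"
  proof -
    have "fps_at (fps_X ^ m) z = z ^ m"
      using fps_at_power[OF fps_abs_conv_entire[OF fps_conv_radius_fps_X], where x = z and k = m]
      by (simp add: fps_at_X)
    then show ?thesis
      using fps_at_compose[OF fps_conv_radius_exp X0 X_nonneg X_conv order_refl, of a z] by simp
  qed
  have F: "fps_conv_radius F = \<infinity>"
    unfolding F_def using fps_conv_radius_mult[of fps_X "fps_exp (- 1 :: real) oo fps_X ^ m"]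
    by (simp add: E_radius)
  have F_at: "fps_at F z = z * fps_at (fps_exp (- 1)) (z ^ m)" for z :: "'c :: unital_banach_algebra"
    unfolding F_def using fps_at_mult[OF fps_abs_conv_entire fps_abs_conv_entire, OF fps_conv_radius_fps_X E_radius]
    by (simp add: fps_at_X E_at)
  then show "fps_at F y = y * fps_at (fps_exp (- 1)) (y ^ m)" .
  have F01: "fps_nth F 0 = 0" "0 < fps_nth F 1" by (simp_all add: F_def)
  have t0: "0 < t0" using m by (simp add: t0_def)
  have t0m: "t0 ^ m = 1 / real m"
    using m by (simp add: t0_def powr_powr flip: powr_realpow)
  have u_radius: "fps_conv_radius u = \<infinity>"
    using m by (simp add: u_def fps_conv_radius_cmult_left)
  have u_nonneg: "0 \<le> fps_nth u k" for k by (simp add: u_def fps_X_power_nth)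
  have u_less: "eval_fps u x < 1" if "0 \<le> x" "x < t0" for x
  proof -
    have "x ^ m < t0 ^ m" using that m by (intro power_strict_mono) auto
    then show ?thesis using m by (simp add: u_def eval_fps_mult t0m field_simps)
  qed
  note inv = inverse_one_minus[OF t0 u_nonneg _ u_less, unfolded u_radius, simplified]
  have "fps_deriv F = (fps_exp (- 1) oo fps_X ^ m)
      + fps_X * ((fps_deriv (fps_exp (- 1)) oo fps_X ^ m) * fps_deriv (fps_X ^ m))"
    unfolding F_def by (simp add: fps_compose_deriv[OF X0])
  also have "fps_deriv (fps_exp (- 1 :: real)) oo fps_X ^ m = - (fps_exp (- 1) oo fps_X ^ m)"
    by (simp add: fps_exp_deriv fps_compose_uminus flip: fps_const_neg)
  also have "fps_X * (- (fps_exp (- 1) oo fps_X ^ m) * fps_deriv (fps_X ^ m))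
      = - (fps_exp (- 1) oo fps_X ^ m) * (fps_X * fps_deriv (fps_X ^ m :: real fps))"
    by (simp add: mult_ac)
  also have "fps_X * fps_deriv (fps_X ^ m :: real fps) = u"
  proof -
    have "fps_X * fps_deriv (fps_X ^ m :: real fps) = fps_const (real m) * (fps_X * fps_X ^ (m - 1))"
      unfolding fps_deriv_power by (simp add: mult_ac)
    then show ?thesis using m by (cases m) (simp_all add: u_def)
  qed
  finally have F': "fps_deriv F = (fps_exp (- 1) oo fps_X ^ m) * (1 - u)" by (simp add: algebra_simps)
  have "(fps_exp 1 oo fps_X ^ m) * (fps_exp (- 1) oo fps_X ^ m) = (1 :: real fps)"
    by (simp add: fps_exp_mult_minus flip: fps_compose_mult_distrib[OF X0])
  moreover have "h * fps_deriv F
      = ((fps_exp 1 oo fps_X ^ m) * (fps_exp (- 1) oo fps_X ^ m)) * (inverse (1 - u) * (1 - u))"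
    unfolding F' h_def u_def[symmetric] by (simp only: mult_ac)
  ultimately have h_inv: "h * fps_deriv F = 1" using inv(3) by simp
  have h_nonneg: "0 \<le> fps_nth h n" for n
    unfolding h_def u_def[symmetric]
  proof (rule fps_mult_nonneg[OF _ inv(1)])
    show "0 \<le> fps_nth (fps_exp (1 :: real) oo fps_X ^ m) k" for k
      unfolding fps_compose_nth
      by (intro sum_nonneg mult_nonneg_nonneg fps_power_nth_nonneg X_nonneg) simp
  qed
  have h_conv: "ereal t0 \<le> fps_conv_radius h"
    unfolding h_def u_def[symmetric] using inv(2)
    by (intro conv_radius_mult_geI) (auto simp: E_radius)
  show "entire_with_positive_inverse F h t0"
    by (unfold_locales; fact F F01 t0 h_inv h_nonneg h_conv)
  have "eval_fps F t0 = t0 * exp (- 1 / real m)"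
    using F_at[of t0] by (simp add: fps_at_real t0m)
  also have "\<dots> = (real m * exp 1) powr (- 1 / real m)"
    using m by (simp add: t0_def powr_mult powr_divide powr_minus_divide exp_powr_real exp_minus field_simps)
  finally show "eval_fps F t0 = (real m * exp 1) powr (- 1 / real m)" .
qed

definition complex_fps :: "real fps \<Rightarrow> complex fps" where
  "complex_fps F = Abs_fps (\<lambda>n. of_real (fps_nth F n))"

lemma complex_fps_nth [simp]: "fps_nth (complex_fps F) n = of_real (fps_nth F n)"
  by (simp add: complex_fps_def)

lemma complex_fps_mult: "complex_fps (F * G) = complex_fps F * complex_fps G"
  by (simp add: fps_eq_iff fps_mult_nth)

lemma fps_conv_radius_complex_fps: "fps_conv_radius (complex_fps F) = fps_conv_radius F"
  using fps_conv_radius_norm[of "complex_fps F"] fps_conv_radius_norm[of F] by simp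

lemma complex_fps_exp: "complex_fps (fps_exp a) = fps_exp (of_real a)"
  and complex_fps_sin: "complex_fps (fps_sin a) = fps_sin (of_real a)"
  and complex_fps_cos: "complex_fps (fps_cos a) = fps_cos (of_real a)"
  by (simp_all add: fps_eq_iff fps_sin_def fps_cos_def)

text \<open>
  At a zero, \<open>(1 + \<i> s) exp (\<i> z) = - (1 - \<i> s) exp (- \<i> z)\<close>; the two coefficients have equal modulus,
  so \<open>z\<close> is real.  The real zeros solve \<open>cot z = s\<close>, and none of them is closer to the origin than
  \<open>arctan_recip s\<close>.
\<close>

lemma cos_minus_sin_nonzero:
  fixes z :: complex
  assumes s: "0 \<le> s" and z: "cmod z < arctan_recip s"
  shows "cos z - of_real s * sin z \<noteq> 0"
proof
  assume zero: "cos z - of_real s * sin z = 0"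
  have "2 * (cos z - of_real s * sin z)
      = (1 + \<i> * of_real s) * exp (\<i> * z) + (1 - \<i> * of_real s) * exp (- (\<i> * z))"
    by (simp add: cos_exp_eq sin_exp_eq field_simps)
  then have "(1 + \<i> * of_real s) * exp (\<i> * z) = - ((1 - \<i> * of_real s) * exp (- (\<i> * z)))"
    using zero by (simp add: eq_neg_iff_add_eq_0)
  then have "cmod ((1 + \<i> * of_real s) * exp (\<i> * z)) = cmod ((1 - \<i> * of_real s) * exp (- (\<i> * z)))"
    by simp
  moreover have "cmod (1 + \<i> * of_real s) = cmod (1 - \<i> * of_real s)"
    by (simp add: cmod_def)
  moreover have "1 - \<i> * of_real s \<noteq> 0" by (simp add: complex_eq_iff)
  ultimately have "exp (- Im z) = exp (Im z)" by (simp add: norm_mult)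
  then have "Im z = 0" by simp
  moreover define x where "x = Re z"
  ultimately have z_eq: "z = of_real x" by (simp add: complex_eq_iff)
  have "of_real (cos x - s * sin x) = (0 :: complex)"
    using zero unfolding z_eq by (simp flip: cos_of_real sin_of_real)
  then have cs: "cos x - s * sin x = 0" using of_real_eq_0_iff by blast
  have "\<bar>x\<bar> < arctan_recip s" using z unfolding z_eq by simp
  have "arctan_recip s \<le> pi / 2"
    using arctan_ubound[of "1 / s"] by (simp add: arctan_recip_def)
  with \<open>\<bar>x\<bar> < arctan_recip s\<close> have x: "- (pi / 2) < x" "x < pi / 2" by auto
  then have cos: "0 < cos x" by (intro cos_gt_zero_pi)
  show False
  proof (cases "0 < x \<and> 0 < s")
    case True
    have "x < arctan (1 / s)" using True \<open>\<bar>x\<bar> < arctan_recip s\<close> by (simp add: arctan_recip_def)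
    then have "tan x < tan (arctan (1 / s))" using x arctan_ubound by (intro tan_monotone) auto
    then have "tan x < 1 / s" by (simp only: tan_arctan)
    then have "s * sin x < cos x" using True cos by (simp add: tan_def field_simps)
    then show False using cs by simp
  next
    case False
    have "s * sin x \<le> 0"
    proof (cases "0 < x")
      case True
      then show ?thesis using False s by simp
    next
      case False
      then have "sin x \<le> 0" using x sin_ge_zero[of "- x"] by simp
      then show ?thesis using s by (simp add: mult_nonneg_nonpos)
    qed
    then show False using cs cos by simp
  qed
qed

text \<open>
  The coefficients of \<open>1 - v\<close> have mixed signs, so \<open>inverse_one_minus\<close> does not apply.  Instead, with
  \<open>\<alpha> = arctan s\<close>, the series \<open>v\<close> is \<open>cos (z + \<alpha>) / cos \<alpha>\<close> and \<open>T = - v' / v\<close> is \<open>tan (z + \<alpha>)\<close>.  The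
  equations \<open>T' = 1 + T^2\<close> and \<open>(1/v)' = T (1/v)\<close> with nonnegative initial values give the signs.
  Convergence follows from holomorphy of \<open>1/v\<close> in the disc up to the complex zero of \<open>v\<close>
  nearest to the origin.
\<close>

lemma inverse_cos_minus_sin:
  fixes s :: real
  assumes s: "0 \<le> s"
  defines "v \<equiv> fps_cos 1 - fps_const s * fps_sin 1"
  shows "inverse v * v = 1" "0 \<le> fps_nth (inverse v) n" "ereal (arctan_recip s) \<le> fps_conv_radius (inverse v)"
proof -
  define w where "w = fps_sin 1 + fps_const s * fps_cos 1"
  define T where "T = w * inverse v"
  have v0: "fps_nth v 0 = 1" by (simp add: v_def)
  show vv: "inverse v * v = 1" using v0 by (intro inverse_mult_eq_1) simp
  have v': "fps_deriv v = - w"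
    by (simp add: v_def w_def fps_cos_deriv fps_sin_deriv flip: fps_const_neg)
  have w': "fps_deriv w = v"
    by (simp add: v_def w_def fps_cos_deriv fps_sin_deriv flip: fps_const_neg)
  have y': "fps_deriv (inverse v) = T * inverse v"
    using fps_inverse_deriv[of v] v0 by (simp add: v' T_def power2_eq_square mult_ac)
  have T': "fps_deriv T = 1 + T * T"
  proof -
    have "fps_deriv T = w * (T * inverse v) + v * inverse v"
      unfolding T_def by (simp add: w' y' T_def)
    then show ?thesis using vv by (simp add: T_def mult_ac)
  qed
  have T_nonneg: "0 \<le> fps_nth T k" for k
  proof (rule fps_nonneg_by_deriv)
    show "0 \<le> fps_nth T 0" using s by (simp add: T_def w_def v_def)
    show "0 \<le> fps_nth (fps_deriv T) n" if "\<And>i. i \<le> n \<Longrightarrow> 0 \<le> fps_nth T i" for n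
      unfolding T' using that by (auto simp: fps_mult_nth fps_one_nth intro!: add_nonneg_nonneg sum_nonneg)
  qed
  show "0 \<le> fps_nth (inverse v) n"
  proof (rule fps_nonneg_by_deriv)
    show "0 \<le> fps_nth (inverse v) 0" by (simp add: v_def)
    show "0 \<le> fps_nth (fps_deriv (inverse v)) n" if "\<And>i. i \<le> n \<Longrightarrow> 0 \<le> fps_nth (inverse v) i" for n
      unfolding y' using that T_nonneg by (subst fps_mult_nth) (auto intro!: sum_nonneg)
  qed
  define f where "f = (\<lambda>z :: complex. inverse (cos z - of_real s * sin z))"
  have cv: "complex_fps v = fps_cos 1 - fps_const (of_real s) * fps_sin 1"
    using complex_fps_cos[of 1] complex_fps_sin[of 1] by (simp add: v_def fps_eq_iff)
  have "(\<lambda>z :: complex. cos z - of_real s * sin z) has_fps_expansion complex_fps v"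
    unfolding cv by (intro fps_expansion_intros)
  then have f: "f has_fps_expansion inverse (complex_fps v)"
    unfolding f_def by (rule has_fps_expansion_inverse) (simp add: v0)
  have "complex_fps v * complex_fps (inverse v) = 1"
    using arg_cong[OF vv, of complex_fps] by (simp add: complex_fps_mult mult.commute fps_eq_iff)
  then have inv: "inverse (complex_fps v) = complex_fps (inverse v)"
    by (rule fps_inverse_unique)
  have "f holomorphic_on eball 0 (ereal (arctan_recip s))"
    unfolding f_def using cos_minus_sin_nonzero[OF s] by (auto intro!: holomorphic_intros)
  then have "ereal (arctan_recip s) \<le> fps_conv_radius (fps_expansion f 0)"
    by (rule conv_radius_fps_expansion)
  also have "fps_expansion f 0 = inverse (complex_fps v)"
    by (simp add: fps_expansion_def fps_eq_iff fps_nth_fps_expansion[OF f])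
  finally show "ereal (arctan_recip s) \<le> fps_conv_radius (inverse v)"
    by (simp add: inv fps_conv_radius_complex_fps)
qed

text \<open>
  Here \<open>F' = exp (- s z) (cos z - s sin z)\<close>, with first positive zero \<open>t0 = arctan_recip s\<close>.
\<close>

lemma exp_sin_positive_inverse:
  fixes s :: real
  assumes s: "0 \<le> s"
  defines "F \<equiv> fps_exp (- s) * fps_sin 1"
    and "h \<equiv> fps_exp s * inverse (fps_cos 1 - fps_const s * fps_sin 1)"
  shows "entire_with_positive_inverse F h (arctan_recip s)"
    and "eval_fps F (arctan_recip s) = exp (- s * arctan_recip s) / sqrt (1 + s\<^sup>2)"
    and "fps_exp (- (of_real s + \<i>)) - fps_exp (- (of_real s - \<i>)) = fps_const (- 2 * \<i>) * complex_fps F"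
proof -
  define v where "v = fps_cos 1 - fps_const s * fps_sin 1"
  note inv = inverse_cos_minus_sin[OF s, folded v_def]
  have F: "fps_conv_radius F = \<infinity>"
    unfolding F_def using fps_conv_radius_mult[of "fps_exp (- s)" "fps_sin 1"] by simp
  have F01: "fps_nth F 0 = 0" "0 < fps_nth F 1" by (simp_all add: F_def fps_mult_nth_1)
  have t0: "0 < arctan_recip s" using s by (simp add: arctan_recip_def)
  have F': "fps_deriv F = fps_exp (- s) * v"
    by (simp add: F_def v_def fps_sin_deriv algebra_simps flip: fps_const_neg)
  have "h * fps_deriv F = (fps_exp s * fps_exp (- s)) * (inverse v * v)"
    unfolding F' h_def v_def[symmetric] by (simp only: mult_ac)
  then have h_inv: "h * fps_deriv F = 1" using inv(1) by (simp add: fps_exp_mult_minus)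
  have h_nonneg: "0 \<le> fps_nth h n" for n
    unfolding h_def v_def[symmetric] using s inv(2) by (intro fps_mult_nonneg) auto
  have h_conv: "ereal (arctan_recip s) \<le> fps_conv_radius h"
    unfolding h_def v_def[symmetric] using inv(3) by (intro conv_radius_mult_geI) auto
  show "entire_with_positive_inverse F h (arctan_recip s)"
    by (unfold_locales; fact F F01 t0 h_inv h_nonneg h_conv)
  have "sin (arctan_recip s) = 1 / sqrt (1 + s\<^sup>2)"
  proof (cases "s = 0")
    case False
    then have "sqrt (1 + (1 / s)\<^sup>2) = sqrt (1 + s\<^sup>2) / s"
      using s by (simp add: real_sqrt_divide[symmetric] field_simps real_sqrt_divide)
    then show ?thesis using False by (simp add: arctan_recip_def sin_arctan)
  qed (simp add: arctan_recip_def)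
  then show "eval_fps F (arctan_recip s) = exp (- s * arctan_recip s) / sqrt (1 + s\<^sup>2)"
    by (simp add: F_def eval_fps_mult)
  have "complex_fps F = fps_exp (- of_real s) * fps_sin 1"
    using complex_fps_sin[of 1] by (simp add: F_def complex_fps_mult complex_fps_exp)
  moreover have "fps_const (- 2 * \<i>) * fps_sin 1 = fps_exp (- \<i>) - fps_exp \<i>"
    by (simp add: fps_sin_fps_exp_ii fps_eq_iff field_simps)
  ultimately have "fps_const (- 2 * \<i>) * complex_fps F = fps_exp (- of_real s) * (fps_exp (- \<i>) - fps_exp \<i>)"
    by (metis mult.left_commute)
  also have "\<dots> = fps_exp (- (of_real s + \<i>)) - fps_exp (- (of_real s - \<i>))"
    by (simp add: right_diff_distrib flip: fps_exp_add_mult)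
  finally show "fps_exp (- (of_real s + \<i>)) - fps_exp (- (of_real s - \<i>)) = fps_const (- 2 * \<i>) * complex_fps F" ..
qed

section \<open>The norm conditions\<close>

lemma op_of_fps_exp_complex:
  fixes x :: "'a :: cbanach cendo"
  assumes FG: "fps_exp a - fps_exp b = fps_const c * complex_fps F"
    and F: "fps_conv_radius F = \<infinity>"
  shows "op_exp (a *\<^sub>C op_of x) - op_exp (b *\<^sub>C op_of x) = c *\<^sub>C op_of (fps_at F x)"
proof -
  have coeff: "a ^ n / fact n - b ^ n / fact n = c * of_real (fps_nth F n)" for n
    using arg_cong[OF FG, of "\<lambda>G. fps_nth G n"] by simp
  have "(\<lambda>n. (a ^ n / fact n) *\<^sub>C op_pow (op_of x) n - (b ^ n / fact n) *\<^sub>C op_pow (op_of x) n)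
      sums (op_exp (a *\<^sub>C op_of x) - op_exp (b *\<^sub>C op_of x))"
    by (intro sums_diff op_exp_scaleC_sums clinear_op_of)
  moreover have "(a ^ n / fact n) *\<^sub>C op_pow (op_of x) n - (b ^ n / fact n) *\<^sub>C op_pow (op_of x) n
      = c *\<^sub>C fps_nth F n *\<^sub>R op_pow (op_of x) n" for n
    using coeff[of n] by (simp add: scaleR_scaleC scaleC_scaleC flip: scaleC_simps(4))
  ultimately have "(\<lambda>n. c *\<^sub>C fps_nth F n *\<^sub>R op_pow (op_of x) n)
      sums (op_exp (a *\<^sub>C op_of x) - op_exp (b *\<^sub>C op_of x))"
    by simp
  moreover have "(\<lambda>n. c *\<^sub>C fps_nth F n *\<^sub>R op_pow (op_of x) n) sums (c *\<^sub>C op_of (fps_at F x))"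
    by (rule bounded_linear.sums[OF bounded_linear_scaleC op_of_fps_at[OF fps_abs_conv_entire[OF F]]])
  ultimately show ?thesis by (rule sums_unique2)
qed

lemma exp_monomial_estimate:
  fixes A :: "'a :: cbanach \<Rightarrow>\<^sub>L 'a" and m :: nat
  assumes A: "clinear_op A" and m: "0 < m"
  shows "((SUP t\<in>{0<..}. ereal (t * norm (A o\<^sub>L op_exp (- (t ^ m *\<^sub>R op_pow A m)))))
            \<le> ereal ((real m * exp 1) powr (- 1 / real m))
          \<longrightarrow> spectral_radius A = norm A)
       \<and> ((SUP t\<in>{0<..}. ereal (t * norm (A o\<^sub>L op_exp (- (t ^ m *\<^sub>R op_pow A m)))))
            < ereal ((real m * exp 1) powr (- 1 / real m))
          \<longrightarrow> A = 0)"
proof (rule entire_with_positive_inverse.supremum_criterion[OF exp_monomial_positive_inverse(1)[OF m] A, where \<kappa> = 1])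
  fix t :: real assume t: "0 < t"
  define x where "x = cendo_of A"
  have x: "op_of x = A" using A by (simp add: x_def cendo_of_inverse)
  define y where "y = t *\<^sub>R x"
  have "- (t ^ m *\<^sub>R op_pow A m) = (- 1) *\<^sub>R op_of (y ^ m)"
    by (simp add: y_def power_scaleR scaleR_cendo.rep_eq op_of_power x)
  then have "op_exp (- (t ^ m *\<^sub>R op_pow A m)) = op_of (fps_at (fps_exp (- 1)) (y ^ m))"
    by (simp only: op_exp_scaleR)
  then have "t *\<^sub>R (A o\<^sub>L op_exp (- (t ^ m *\<^sub>R op_pow A m))) = op_of (y * fps_at (fps_exp (- 1)) (y ^ m))"
    by (simp add: y_def times_cendo.rep_eq scaleR_cendo.rep_eq x)
  then have "norm (t *\<^sub>R (A o\<^sub>L op_exp (- (t ^ m *\<^sub>R op_pow A m)))) = norm (y * fps_at (fps_exp (- 1)) (y ^ m))"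
    by (simp only: norm_op_of)
  then show "t * norm (A o\<^sub>L op_exp (- (t ^ m *\<^sub>R op_pow A m)))
      = 1 * norm (fps_at (fps_X * (fps_exp (- 1) oo fps_X ^ m)) (t *\<^sub>R cendo_of A))"
    using t by (simp add: exp_monomial_positive_inverse(3)[OF m] y_def x_def)
qed (simp_all add: exp_monomial_positive_inverse(2)[OF m])

lemma exp_difference_estimate:
  fixes A :: "'a :: cbanach \<Rightarrow>\<^sub>L 'a" and s :: real
  assumes A: "clinear_op A" and s: "1 < s"
  shows "((SUP t\<in>{0<..}. ereal (norm (op_exp (- (t *\<^sub>R A)) - op_exp (- ((s * t) *\<^sub>R A)))))
            \<le> ereal ((s - 1) * s powr (- s / (s - 1)))
          \<longrightarrow> spectral_radius A = norm A)
       \<and> ((SUP t\<in>{0<..}. ereal (norm (op_exp (- (t *\<^sub>R A)) - op_exp (- ((s * t) *\<^sub>R A)))))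
            < ereal ((s - 1) * s powr (- s / (s - 1)))
          \<longrightarrow> A = 0)"
proof (rule entire_with_positive_inverse.supremum_criterion[OF exp_difference_positive_inverse(1)[OF s] A, where \<kappa> = 1])
  fix t :: real assume t: "0 < t"
  define x where "x = t *\<^sub>R cendo_of A"
  have x: "op_of x = t *\<^sub>R A" using A by (simp add: x_def cendo_of_inverse scaleR_cendo.rep_eq)
  have "fps_at (fps_exp (- 1) - fps_exp (- s)) x = fps_at (fps_exp (- 1)) x - fps_at (fps_exp (- s)) x"
  proof -
    have "(\<lambda>n. fps_nth (fps_exp (- 1)) n *\<^sub>R x ^ n - fps_nth (fps_exp (- s)) n *\<^sub>R x ^ n)
        sums (fps_at (fps_exp (- 1)) x - fps_at (fps_exp (- s)) x)"
      by (intro sums_diff fps_at_sums fps_abs_conv_entire fps_conv_radius_exp)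
    then show ?thesis by (simp add: fps_at_def sums_iff flip: scaleR_diff_left)
  qed
  then have "op_of (fps_at (fps_exp (- 1) - fps_exp (- s)) x)
      = op_exp ((- 1) *\<^sub>R op_of x) - op_exp ((- s) *\<^sub>R op_of x)"
    by (simp only: minus_cendo.rep_eq op_exp_scaleR)
  then have "op_of (fps_at (fps_exp (- 1) - fps_exp (- s)) x)
      = op_exp (- (t *\<^sub>R A)) - op_exp (- ((s * t) *\<^sub>R A))"
    by (simp add: x)
  then show "norm (op_exp (- (t *\<^sub>R A)) - op_exp (- ((s * t) *\<^sub>R A)))
      = 1 * norm (fps_at (fps_exp (- 1) - fps_exp (- s)) (t *\<^sub>R cendo_of A))"
    by (simp add: x_def flip: norm_op_of)
qed (simp_all add: exp_difference_positive_inverse(2)[OF s])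

lemma exp_sin_estimate:
  fixes A :: "'a :: cbanach \<Rightarrow>\<^sub>L 'a" and s :: real
  assumes A: "clinear_op A" and s: "0 \<le> s"
  shows "((SUP t\<in>{0<..}. ereal (norm
            (op_exp (- (((of_real s + \<i>) * of_real t) *\<^sub>C A))
             - op_exp (- (((of_real s - \<i>) * of_real t) *\<^sub>C A)))))
            \<le> ereal (2 * exp (- s * arctan_recip s) / sqrt (1 + s\<^sup>2))
          \<longrightarrow> spectral_radius A = norm A)
       \<and> ((SUP t\<in>{0<..}. ereal (norm
            (op_exp (- (((of_real s + \<i>) * of_real t) *\<^sub>C A))
             - op_exp (- (((of_real s - \<i>) * of_real t) *\<^sub>C A)))))
            < ereal (2 * exp (- s * arctan_recip s) / sqrt (1 + s\<^sup>2))
          \<longrightarrow> A = 0)"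
proof (rule entire_with_positive_inverse.supremum_criterion[OF exp_sin_positive_inverse(1)[OF s] A, where \<kappa> = 2])
  fix t :: real assume t: "0 < t"
  define x where "x = t *\<^sub>R cendo_of A"
  have x: "op_of x = complex_of_real t *\<^sub>C A"
    using A unfolding x_def scaleR_cendo.rep_eq scaleR_scaleC[of t A, symmetric]
    by (simp add: cendo_of_inverse)
  have minus: "- ((z * of_real t) *\<^sub>C A) = (- z) *\<^sub>C op_of x" for z
    by (simp add: x scaleC_scaleC linear_neg[OF bounded_linear.linear[OF bounded_linear_scaleC_left]])
  have "op_exp (- (((of_real s + \<i>) * of_real t) *\<^sub>C A)) - op_exp (- (((of_real s - \<i>) * of_real t) *\<^sub>C A))
      = (- 2 * \<i>) *\<^sub>C op_of (fps_at (fps_exp (- s) * fps_sin 1) x)"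
    unfolding minus by (rule op_of_fps_exp_complex[OF exp_sin_positive_inverse(3)[OF s] entire_with_positive_inverse.F(1)[OF exp_sin_positive_inverse(1)[OF s]]])
  then show "norm (op_exp (- (((of_real s + \<i>) * of_real t) *\<^sub>C A))
        - op_exp (- (((of_real s - \<i>) * of_real t) *\<^sub>C A)))
      = 2 * norm (fps_at (fps_exp (- s) * fps_sin 1) (t *\<^sub>R cendo_of A))"
    by (simp add: norm_scaleC norm_op_of norm_mult x_def)
qed (simp_all add: exp_sin_positive_inverse(2)[OF s])

theorem theorem4p12:
  fixes A :: "'a :: cbanach \<Rightarrow>\<^sub>L 'a"
  assumes "clinear_op A"
  shows
    "(((SUP t\<in>{0<..}. ereal (t * norm (A o\<^sub>L op_exp (- (t *\<^sub>R A))))) \<le> ereal (exp (- 1))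
        \<longrightarrow> spectral_radius A = norm A)
     \<and> ((SUP t\<in>{0<..}. ereal (t * norm (A o\<^sub>L op_exp (- (t *\<^sub>R A))))) < ereal (exp (- 1))
        \<longrightarrow> A = 0))
     \<and> (\<forall>m::nat. 1 < m \<longrightarrow>
       ((SUP t\<in>{0<..}. ereal (t * norm (A o\<^sub>L op_exp (- (t ^ m *\<^sub>R op_pow A m)))))
            \<le> ereal ((real m * exp 1) powr (- 1 / real m))
          \<longrightarrow> spectral_radius A = norm A)
       \<and> ((SUP t\<in>{0<..}. ereal (t * norm (A o\<^sub>L op_exp (- (t ^ m *\<^sub>R op_pow A m)))))
            < ereal ((real m * exp 1) powr (- 1 / real m))
          \<longrightarrow> A = 0))
     \<and> (\<forall>s::real. 1 < s \<longrightarrow>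
       ((SUP t\<in>{0<..}. ereal (norm (op_exp (- (t *\<^sub>R A)) - op_exp (- ((s * t) *\<^sub>R A)))))
            \<le> ereal ((s - 1) * s powr (- s / (s - 1)))
          \<longrightarrow> spectral_radius A = norm A)
       \<and> ((SUP t\<in>{0<..}. ereal (norm (op_exp (- (t *\<^sub>R A)) - op_exp (- ((s * t) *\<^sub>R A)))))
            < ereal ((s - 1) * s powr (- s / (s - 1)))
          \<longrightarrow> A = 0))
     \<and> (\<forall>s::real. 0 \<le> s \<longrightarrow>
       ((SUP t\<in>{0<..}. ereal (norm
            (op_exp (- (((of_real s + \<i>) * of_real t) *\<^sub>C A))
             - op_exp (- (((of_real s - \<i>) * of_real t) *\<^sub>C A)))))
            \<le> ereal (2 * exp (- s * arctan_recip s) / sqrt (1 + s\<^sup>2))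
          \<longrightarrow> spectral_radius A = norm A)
       \<and> ((SUP t\<in>{0<..}. ereal (norm
            (op_exp (- (((of_real s + \<i>) * of_real t) *\<^sub>C A))
             - op_exp (- (((of_real s - \<i>) * of_real t) *\<^sub>C A)))))
            < ereal (2 * exp (- s * arctan_recip s) / sqrt (1 + s\<^sup>2))
          \<longrightarrow> A = 0))"
proof -
  have "op_pow A 1 = A" by (rule blinfun_eqI) (simp add: op_pow_def)
  then have 1: "((SUP t\<in>{0<..}. ereal (t * norm (A o\<^sub>L op_exp (- (t *\<^sub>R A))))) \<le> ereal (exp (- 1))
        \<longrightarrow> spectral_radius A = norm A)
     \<and> ((SUP t\<in>{0<..}. ereal (t * norm (A o\<^sub>L op_exp (- (t *\<^sub>R A))))) < ereal (exp (- 1))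
        \<longrightarrow> A = 0)"
    using exp_monomial_estimate[OF assms, of 1] by (simp add: exp_powr_real exp_minus inverse_eq_divide)
  show ?thesis
    by (rule conjI[OF 1 conjI[OF allI[OF impI] conjI[OF allI[OF impI] allI[OF impI]]]],
        rule exp_monomial_estimate[OF assms], simp,
        rule exp_difference_estimate[OF assms], assumption,
        rule exp_sin_estimate[OF assms], assumption)
qed

end
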